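(* Let $f$ be an inner function with $f(0)=0$ which is not a rotation. Let $\{a_n\}$ be a sequence of complex numbers. Consider $$\sigma_N^2=\sum_{n=1}^{N}|a_n|^2+2\,\mathrm{Re}\sum_{k=1}^{N} f'(0)^k\sum_{n=1}^{N-k}\overline{a_n}\,a_{n+k},\quad N=1,2,\ldots$$ Assume there exists a constant $\eta>0$ such that $$\lim_{N\to\infty}\frac{\sup\{|a_n|^2: n\le N\}}{\left(\sum_{n=1}^{N}|a_n|^2\right)^{(1-\eta)/2}}=0.$$ Then $$\frac{1}{\sqrt{2}\,\sigma_N}\sum_{n=1}^{N}a_n f^n$$ converges in distribution, as $N\to\infty$, to a standard complex normal variable.
   Context: $\mathbb{D}$ is the open unit disc and $m$ is normalized Lebesgue measure on the unit circle $\partial\mathbb{D}$. An inner function is an analytic map $f:\mathbb{D}\to\mathbb{D}$ whose radial limits have modulus one at $m$-almost every point of $\partial\mathbb{D}$; the boundary function, defined $m$-a.e. by $f(z)=\lim_{r\to1}f(rz)$, is also denoted $f$. A rotation is a map $z\mapsto cz$ with $|c|=1$. $f^n$ denotes the $n$-th iterate of $f$ (not the power), regarded here as a function defined $m$-a.e. on $\partial\mathbb{D}$. A sequence $\{f_N\}$ of measurable functions defined at almost every point of $\partial\mathbb{D}$ is said to converge in distribution to a (circularly symmetric) standard complex normal variable if for any measurable set $K\subset\mathbb{C}$, $$\lim_{N\to\infty}m(\{z\in\partial\mathbb{D}: f_N(z)\in K\})=\frac{1}{2\pi}\int_K e^{-|w|^2/2}\,dA(w),$$ where $dA$ is area measure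 on $\mathbb{C}$.
   Formalization: The factor 1/(√2 σ_N) is replaced by √2/σ_N (the printed one gives mean square 1/2, but the limit law has 2); convergence in distribution is tested only on Borel sets K with boundary of area zero (it fails for arbitrary measurable K); the a_n are assumed not all zero. *)

theory Defs
  imports "HOL-Complex_Analysis.Complex_Analysis"
begin

text \<open>Normalized Lebesgue measure on the unit circle; its space is the circle itself.\<close>

definition circle_measure :: "complex measure" where
  "circle_measure =
     distr (uniform_measure lborel {0..<2 * pi}) (restrict_space borel (sphere 0 1)) cis"

definition inner_function :: "(complex \<Rightarrow> complex) \<Rightarrow> bool" where
  "inner_function f \<longleftrightarrow>
     f holomorphic_on ball 0 1 \<and>
     f ` ball 0 1 \<subseteq> ball 0 1 \<and>
     (AE z in circle_measure.
        \<exists>w. norm w = 1 \<and> ((\<lambda>r. f (complex_of_real r * z)) \<longlongrightarrow> w) (at_left 1))"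

text \<open>
  At points of the circle where the radial limit does not exist (a null set for inner
  functions), the value is an unspecified constant.
\<close>

definition boundary_function :: "(complex \<Rightarrow> complex) \<Rightarrow> complex \<Rightarrow> complex" where
  "boundary_function f z = Lim (at_left 1) (\<lambda>r. f (complex_of_real r * z))"

text \<open>Only the values of a map on the open unit disc matter.\<close>

definition disc_rotation :: "(complex \<Rightarrow> complex) \<Rightarrow> bool" where
  "disc_rotation f \<longleftrightarrow> (\<exists>c. norm c = 1 \<and> (\<forall>z\<in>ball 0 1. f z = c * z))"

text \<open>
  The mean square over the circle of the sum of \<open>a n\<close> times the \<open>n\<close>-th iterate of \<open>f\<close> is
  \<open>sigma_squared f a N\<close>, whereas the limit law below has second moment 2.  Hence the sums have to
  be multiplied by \<open>sqrt 2 / sigma\<close>; with the factor \<open>1 / (sqrt 2 * sigma)\<close> the mean square would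
  be \<open>1 / 2\<close> for every \<open>N\<close> with \<open>sigma > 0\<close>, which is incompatible with that limit law.
\<close>

definition sigma_squared :: "(complex \<Rightarrow> complex) \<Rightarrow> (nat \<Rightarrow> complex) \<Rightarrow> nat \<Rightarrow> real" where
  "sigma_squared f a N =
     (\<Sum>n=1..N. (norm (a n))\<^sup>2) +
     2 * Re (\<Sum>k=1..N. deriv f 0 ^ k * (\<Sum>n=1..N - k. cnj (a n) * a (n + k)))"

text \<open>
  The limit law has density \<open>exp (- |w|\<^sup>2 / 2) / (2 * pi)\<close> with respect to area: real and
  imaginary parts are independent with variance one.  The test sets \<open>K\<close> are the Borel sets whose
  boundary has area zero, i.e. the continuity sets of the limit law, as usual for convergence in
  distribution.  For arbitrary measurable \<open>K\<close> the condition would fail, for instance, whenever all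
  \<open>F N\<close> are trigonometric polynomials: the union of their images is a Borel set of area zero.
\<close>

definition converges_to_standard_complex_normal :: "(nat \<Rightarrow> complex \<Rightarrow> complex) \<Rightarrow> bool" where
  "converges_to_standard_complex_normal F \<longleftrightarrow>
     (\<forall>N. F N \<in> borel_measurable circle_measure) \<and>
     (\<forall>K \<in> sets borel. frontier K \<in> null_sets lborel \<longrightarrow>
        (\<lambda>N. measure circle_measure {z \<in> space circle_measure. F N z \<in> K})
          \<longlonglongrightarrow> 1 / (2 * pi) * (LINT w:K|lborel. exp (- (norm w)\<^sup>2 / 2)))"

end

theory Submission
  imports Defs "HOL-Probability.Probability"
begin

text \<open>
  The boundary map \<open>T\<close> of \<open>f\<close> preserves \<open>m\<close>, because the Fourier coefficients
  of the powers of \<open>T\<close> are boundary values of Taylor coefficients: for \<open>k \<ge> 1\<close> the mean of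
  \<open>T ^ k\<close> is \<open>f 0 ^ k = 0\<close>.  The same comparison of Fourier coefficients computes conditional
  expectations given \<open>T\<close>.  With \<open>c\<close> the conjugate of \<open>f'(0)\<close>, the conditional expectation of the
  coordinate \<open>z\<close> is \<open>c T\<close>, and that of \<open>z\<^sup>2\<close> is \<open>q T + c\<^sup>2 T\<^sup>2\<close> for some constant \<open>q\<close>
  (lemmas \<open>boundary_first_moment\<close> and \<open>boundary_second_moment\<close>); here \<open>norm c < 1\<close> by the
  Schwarz lemma, since \<open>f\<close> is not a rotation.

  Hence \<open>z - c T\<close> composed with the iterates \<open>T ^^ n\<close> is a sequence of reverse martingale differences:
  each has conditional mean zero given all later iterates.  Its conditional variance is the
  \<^emph>\<open>constant\<close> \<open>1 - (norm c)\<^sup>2\<close>, because \<open>norm T = 1\<close>, and its conditional second moment without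
  conjugation is \<open>q\<close> times the next iterate.  Writing \<open>b m = (\<Sum>k=1..m. a k * c ^ (m - k))\<close>, summation
  by parts turns the sum of the \<open>a n * T ^^ n\<close> for \<open>n \<le> N\<close> into the sum of the reverse martingale
  differences with the weights \<open>b m\<close>, up to one boundary term, and it shows that
  \<open>sigma_squared\<close> is \<open>(1 - (norm c)\<^sup>2)\<close> times the sum of the \<open>(norm (b m))\<^sup>2\<close>, up to the variance
  of that boundary term (lemma \<open>sigma_squared_geometric_sum\<close>).  The growth hypothesis makes each
  weight negligible compared with \<open>sigma\<close>.

  The characteristic function of the normalized sum is then computed by removing one difference
  after another (lemma \<open>E_phase\<close>).  Removing the difference with normalized weight \<open>\<beta>\<close> costs a factor
  \<open>exp (- v / 2)\<close>, with \<open>v\<close> its deterministic conditional variance, up to a cubic error and a term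
  \<open>q \<beta>\<^sup>2\<close> times the mean of the next iterate against the remaining phase.  The latter mean is small as
  well, because correlations of the iterates decay like powers of \<open>c\<close> (lemma \<open>E_z_phase\<close>).  So
  the characteristic functions converge to that of the standard complex normal law.  Since the second
  moments are bounded, a continuity theorem in the plane (lemma \<open>continuity_theorem_complex\<close>, proved
  with the Weierstrass theorem) and the portmanteau argument (lemma \<open>weak_limit_continuity_set\<close>)
  finish the proof.
\<close>

section \<open>Normalized Lebesgue measure on the circle\<close>

lemma prob_space_circle_measure: "prob_space circle_measure"
proof -
  have "prob_space (uniform_measure lborel {0..<2 * pi})"
    by (rule prob_space_uniform_measure) auto
  moreover have "cis \<in> lborel \<rightarrow>\<^sub>M restrict_space borel (sphere 0 1)"
    by (intro measurable_restrict_space2) (auto intro!: borel_measurable_continuous_onI continuous_intros)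
  ultimately show ?thesis
    unfolding circle_measure_def
    by (intro prob_space.prob_space_distr) (auto simp: measurable_def)
qed

interpretation circle: prob_space circle_measure
  by (rule prob_space_circle_measure)

lemma space_circle_measure [simp]: "space circle_measure = sphere 0 1"
  by (simp add: circle_measure_def space_restrict_space)

lemma sets_circle_measure:
  "sets circle_measure = sets (restrict_space borel (sphere 0 1))"
  by (simp add: circle_measure_def)

lemma borel_measurable_circleI:
  "g \<in> borel_measurable borel \<Longrightarrow> g \<in> borel_measurable circle_measure"
  by (simp cong: measurable_cong_sets add: sets_circle_measure measurable_restrict_space1)

lemma measurable_cnj [measurable]: "cnj \<in> borel_measurable borel"
  by (intro borel_measurable_continuous_onI continuous_intros)

lemma circle_id: "(\<lambda>z. z) \<in> borel_measurable circle_measure"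
  by (rule borel_measurable_circleI) simp

lemma integrable_circle_bounded:
  fixes g :: "complex \<Rightarrow> 'b::{banach, second_countable_topology}"
  assumes "g \<in> borel_measurable circle_measure" and "\<And>z. norm z = 1 \<Longrightarrow> norm (g z) \<le> B"
  shows "integrable circle_measure g"
  using assms by (intro circle.integrable_const_bound[where B = B] AE_I2) auto

lemma integral_circle_measure:
  fixes g :: "complex \<Rightarrow> complex"
  assumes g: "g \<in> borel_measurable circle_measure"
  shows "(LINT z|circle_measure. g z) =
           (LINT t|lborel. indicator {0..<2*pi} t *\<^sub>R g (cis t)) / (2 * pi)"
proof -
  have cis: "cis \<in> lborel \<rightarrow>\<^sub>M restrict_space borel (sphere 0 1)"
    by (intro measurable_restrict_space2) (auto intro!: borel_measurable_continuous_onI continuous_intros)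
  have g': "g \<in> restrict_space borel (sphere 0 1) \<rightarrow>\<^sub>M borel"
    using g by (simp cong: measurable_cong_sets add: sets_circle_measure)
  have [measurable]: "(\<lambda>t. g (cis t)) \<in> borel_measurable lborel"
    using measurable_compose[OF cis g'] by simp
  have "(LINT z|circle_measure. g z) = (LINT t|uniform_measure lborel {0..<2*pi}. g (cis t))"
    unfolding circle_measure_def using cis g'
    by (intro integral_distr) (auto simp: measurable_def)
  also have "\<dots> = (LINT t|density lborel (\<lambda>t. ennreal (indicator {0..<2*pi} t / (2*pi))). g (cis t))"
    unfolding uniform_measure_def
    by (intro arg_cong2[where f = "integral\<^sup>L"] density_cong)
       (auto simp: ennreal_indicator divide_ennreal simp flip: ennreal_indicator split: split_indicator)
  also have "\<dots> = (LINT t|lborel. (indicator {0..<2*pi} t / (2*pi)) *\<^sub>R g (cis t))"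
    by (subst integral_density) auto
  also have "\<dots> = (LINT t|lborel. (indicator {0..<2*pi} t *\<^sub>R g (cis t)) / (2 * pi))"
    by (intro Bochner_Integration.integral_cong) (auto simp: scaleR_conv_of_real)
  finally show ?thesis by simp
qed

text \<open>
  This is Cauchy's integral formula at the centre, transported from contour integrals to
  \<open>circle_measure\<close>.
\<close>

lemma circle_mean_value:
  assumes h: "h holomorphic_on ball 0 1" and r: "0 < r" "r < 1"
  shows "(LINT z|circle_measure. h (of_real r * z)) = h 0"
proof -
  have hol: "h holomorphic_on cball 0 r"
    using h by (rule holomorphic_on_subset) (use r in auto)
  have cont: "continuous_on (cball 0 r) h"
    using hol by (rule holomorphic_on_imp_continuous_on)
  have cont': "continuous_on (sphere 0 1) (\<lambda>z. h (of_real r * z))"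
    by (rule continuous_on_compose2[OF cont]) (use r in \<open>auto intro!: continuous_intros simp: norm_mult\<close>)
  have contc: "continuous_on A (\<lambda>t. h (of_real r * cis t))" for A
    by (rule continuous_on_compose2[OF cont]) (use r in \<open>auto intro!: continuous_intros simp: norm_mult\<close>)
  have "((\<lambda>u. h u / (u - 0)) has_contour_integral (2 * of_real pi * \<i> * h 0)) (circlepath 0 r)"
    by (rule Cauchy_integral_circlepath_simple[OF hol]) (use r in auto)
  then have "((\<lambda>t. h (0 + r * cis t) / (0 + r * cis t - 0) * r * \<i> * cis t) has_integral
               (2 * of_real pi * \<i> * h 0)) {0..2*pi}"
    unfolding circlepath_def by (subst (asm) has_contour_integral_part_circlepath_iff) auto
  also have "(\<lambda>t. h (0 + r * cis t) / (0 + r * cis t - 0) * r * \<i> * cis t) =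
             (\<lambda>t. \<i> * h (r * cis t))"
    using r by (auto simp: fun_eq_iff)
  finally have hk: "integral {0..2*pi} (\<lambda>t. \<i> * h (r * cis t)) = 2 * of_real pi * \<i> * h 0"
    by (rule integral_unique)
  have "(LINT z|circle_measure. h (of_real r * z)) =
          (LINT t|lborel. indicator {0..<2*pi} t *\<^sub>R h (of_real r * cis t)) / (2 * pi)"
    by (rule integral_circle_measure)
       (simp cong: measurable_cong_sets add: sets_circle_measure borel_measurable_continuous_on_restrict cont')
  also have "(LINT t|lborel. indicator {0..<2*pi} t *\<^sub>R h (of_real r * cis t)) =
             (LINT t:{0..2*pi}|lborel. h (of_real r * cis t))"
    unfolding set_lebesgue_integral_def
  proof (rule integral_cong_AE)
    have "h \<circ> (\<lambda>t. of_real r * cis t) \<in> borel_measurable borel"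
      using contc[of UNIV] by (intro borel_measurable_continuous_onI) (simp add: o_def)
    then have [measurable]: "(\<lambda>t. h (of_real r * cis t)) \<in> borel_measurable borel"
      by (simp add: o_def)
    show "(\<lambda>t. indicator {0..<2*pi} t *\<^sub>R h (of_real r * cis t)) \<in> borel_measurable lborel"
         "(\<lambda>t. indicator {0..2*pi} t *\<^sub>R h (of_real r * cis t)) \<in> borel_measurable lborel"
      by measurable
    show "AE t in lborel. indicator {0..<2*pi} t *\<^sub>R h (of_real r * cis t) =
            indicator {0..2*pi} t *\<^sub>R h (of_real r * cis t)"
      using AE_lborel_singleton[of "2*pi"] by eventually_elim (auto split: split_indicator)
  qed
  also have "\<dots> = integral {0..2*pi} (\<lambda>t. h (of_real r * cis t))"
    by (rule set_borel_integral_eq_integral(2))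
       (intro borel_integrable_atLeastAtMost' contc)
  also have "\<dots> = 2 * pi * h 0"
    using hk by simp
  finally show ?thesis by simp
qed

section \<open>Approximation of continuous functions and of indicators\<close>

text \<open>
  To prove a property of all \<open>p \<circ> g\<close> with \<open>p\<close> a polynomial in the real and imaginary parts, it is
  enough that the property is linear and stable under multiplication by these two coordinates.
  The factor \<open>u\<close> is carried along so that products of polynomials need no extra hypothesis.
  Together with the Weierstrass theorem this reaches continuous functions, on the circle with
  \<open>g\<close> the identity and in the plane with \<open>g\<close> built from sines.
\<close>

lemma real_polynomial_function_induct_mult:
  fixes P :: "('b \<Rightarrow> complex) \<Rightarrow> bool" and g :: "'b \<Rightarrow> complex"
  assumes p: "real_polynomial_function p" and u: "P u"
    and add: "\<And>u v. P u \<Longrightarrow> P v \<Longrightarrow> P (\<lambda>z. u z + v z)"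
    and scale: "\<And>u a. P u \<Longrightarrow> P (\<lambda>z. a * u z)"
    and Re: "\<And>u. P u \<Longrightarrow> P (\<lambda>z. u z * of_real (Re (g z)))"
    and Im: "\<And>u. P u \<Longrightarrow> P (\<lambda>z. u z * of_real (Im (g z)))"
  shows "P (\<lambda>z. u z * of_real (p (g z)))"
  using p u
proof (induction p arbitrary: u rule: real_polynomial_function.induct)
  case (linear f)
  interpret bounded_linear f by fact
  have f: "f w = Re w * f 1 + Im w * f \<i>" for w
  proof -
    have "w = Re w *\<^sub>R 1 + Im w *\<^sub>R \<i>" by (simp add: complex_eq_iff)
    then have "f w = f (Re w *\<^sub>R 1 + Im w *\<^sub>R \<i>)" by simp
    then show ?thesis by (simp only: add scaleR real_scaleR_def)
  qed
  have "(\<lambda>z. u z * of_real (f (g z))) =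
     (\<lambda>z. of_real (f 1) * (u z * of_real (Re (g z))) + of_real (f \<i>) * (u z * of_real (Im (g z))))"
    by (subst f) (simp add: distrib_left mult_ac)
  then show ?case
    using assms(3)[OF assms(4)[OF assms(5)[OF linear.prems], of "of_real (f 1)"]
                      assms(4)[OF assms(6)[OF linear.prems], of "of_real (f \<i>)"]]
    by simp
next
  case (const c)
  then show ?case using scale[of u "of_real c"] by (simp add: mult.commute)
next
  case (add f g')
  then show ?case using assms(3)[OF add.IH[OF add.prems]] by (simp add: distrib_left)
next
  case (mult f g')
  then show ?case using mult.IH(2)[OF mult.IH(1)[OF mult.prems]] by (simp add: mult.assoc)
qed

text \<open>
  Continuous functions decreasing to the indicator of a nonempty closed set.
\<close>

definition plateau :: "complex set \<Rightarrow> nat \<Rightarrow> complex \<Rightarrow> real" where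
  "plateau C k z = max 0 (1 - real k * infdist z C)"

lemma continuous_plateau: "continuous_on A (plateau C k)"
  unfolding plateau_def by (intro continuous_intros)

lemma borel_measurable_plateau [measurable]: "plateau C k \<in> borel_measurable borel"
  by (intro borel_measurable_continuous_onI continuous_plateau)

lemma plateau_bounds: "0 \<le> plateau C k z" "plateau C k z \<le> 1"
  by (auto simp: plateau_def infdist_nonneg)

lemma plateau_eq_1: "z \<in> C \<Longrightarrow> plateau C k z = 1"
  by (simp add: plateau_def)

lemma plateau_tendsto_indicator:
  assumes "closed C" "C \<noteq> {}"
  shows "(\<lambda>k. plateau C k z) \<longlonglongrightarrow> indicator C z"
proof (cases "z \<in> C")
  case True then show ?thesis by (simp add: plateau_eq_1)
next
  case False
  then have pos: "infdist z C > 0"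
    using assms by (simp add: infdist_pos_not_in_closed)
  obtain k0 :: nat where k0: "real k0 * infdist z C \<ge> 1"
    using reals_Archimedean3[OF pos] by (meson less_imp_le)
  have "\<forall>\<^sub>F k in sequentially. plateau C k z = 0"
    unfolding eventually_sequentially
  proof (intro exI allI impI)
    fix k assume "k0 \<le> k"
    then have "real k0 * infdist z C \<le> real k * infdist z C"
      using pos by (intro mult_right_mono) auto
    then show "plateau C k z = 0" using k0 by (simp add: plateau_def)
  qed
  then show ?thesis using False by (simp add: tendsto_eventually)
qed

section \<open>Conditional moments from Fourier coefficients\<close>

lemma complex_eqI_small:
  fixes x y :: complex
  assumes "\<And>e. e > 0 \<Longrightarrow> norm (x - y) \<le> K * e"
  shows "x = y"
proof -
  have "norm (x - y) \<le> 0 + e" if "e > 0" for e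
  proof -
    have "norm (x - y) \<le> K * (e / (\<bar>K\<bar> + 1))"
      using assms[of "e / (\<bar>K\<bar> + 1)"] that by (simp add: field_simps)
    also have "\<dots> \<le> e"
      using that by (simp add: field_simps abs_if)
    finally show ?thesis by simp
  qed
  then have "norm (x - y) \<le> 0" by (rule field_le_epsilon)
  then show ?thesis by simp
qed

lemma sets_circle_imp_borel: "A \<in> sets circle_measure \<Longrightarrow> A \<in> sets borel"
  by (auto simp: sets_circle_measure sets_restrict_space)

context
  fixes T u v :: "complex \<Rightarrow> complex" and B :: real
  assumes T: "T \<in> circle_measure \<rightarrow>\<^sub>M circle_measure"
    and u [measurable]: "u \<in> borel_measurable circle_measure"
    and v [measurable]: "v \<in> borel_measurable circle_measure"
    and ub: "\<And>z. norm z = 1 \<Longrightarrow> norm (u z) \<le> B"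
    and vb: "\<And>z. norm z = 1 \<Longrightarrow> norm (v z) \<le> B"
    and eq: "\<And>j k. (LINT z|circle_measure. u z * (T z ^ j * cnj (T z) ^ k)) =
                    (LINT z|circle_measure. v z * (z ^ j * cnj z ^ k))"
begin

lemma norm_sphere_map: "norm z = 1 \<Longrightarrow> norm (T z) = 1"
  using measurable_space[OF T, of z] by simp

lemma borel_sphere_map: "h \<in> borel_measurable borel \<Longrightarrow> (\<lambda>z. h (T z)) \<in> borel_measurable circle_measure"
  by (rule measurable_compose[OF T borel_measurable_circleI])

lemma multiplier_bound_nonneg: "0 \<le> B"
  using order_trans[OF norm_ge_zero ub[of 1]] by simp

text \<open>
  On the circle every polynomial in the real and imaginary parts is a trigonometric polynomial, so
  the hypothesis on mixed powers determines the integral.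
\<close>

lemma integral_polynomial_of_factor:
  assumes p: "real_polynomial_function p"
  shows "(LINT z|circle_measure. u z * of_real (p (T z))) = (LINT z|circle_measure. v z * of_real (p z))"
proof -
  define P where "P h \<longleftrightarrow> h \<in> borel_measurable borel \<and> (\<exists>C. \<forall>z. norm z = 1 \<longrightarrow> norm (h z) \<le> C) \<and>
     (\<forall>j k. (LINT z|circle_measure. u z * (h (T z) * (T z ^ j * cnj (T z) ^ k))) =
             (LINT z|circle_measure. v z * (h z * (z ^ j * cnj z ^ k))))" for h :: "complex \<Rightarrow> complex"
  have int1: "integrable circle_measure (\<lambda>z. u z * (h (T z) * (T z ^ j * cnj (T z) ^ k)))"
    and int2: "integrable circle_measure (\<lambda>z. v z * (h z * (z ^ j * cnj z ^ k)))"
    if "P h" for h j k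
  proof -
    from that have [measurable]: "h \<in> borel_measurable borel" by (simp add: P_def)
    note [measurable] = circle_id borel_sphere_map[OF this] borel_measurable_circleI[OF this] borel_sphere_map[of "\<lambda>z. z", simplified]
    from that obtain C where C: "\<And>z. norm z = 1 \<Longrightarrow> norm (h z) \<le> C" by (auto simp: P_def)
    show "integrable circle_measure (\<lambda>z. u z * (h (T z) * (T z ^ j * cnj (T z) ^ k)))"
      using multiplier_bound_nonneg
      by (intro integrable_circle_bounded[where B = "B * C"])
         (measurable, auto simp: norm_mult norm_power norm_sphere_map intro!: mult_mono ub C)
    show "integrable circle_measure (\<lambda>z. v z * (h z * (z ^ j * cnj z ^ k)))"
      using multiplier_bound_nonneg
      by (intro integrable_circle_bounded[where B = "B * C"])
         (measurable, auto simp: norm_mult norm_power intro!: mult_mono vb C)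
  qed
  have add: "P (\<lambda>z. g z + h z)" if g: "P g" and h: "P h" for g h
  proof -
    from g h obtain C D where C: "\<forall>z. norm z = 1 \<longrightarrow> norm (g z) \<le> C" "\<forall>z. norm z = 1 \<longrightarrow> norm (h z) \<le> D"
      by (auto simp: P_def)
    then have "\<forall>z. norm z = 1 \<longrightarrow> norm (g z + h z) \<le> C + D"
      by (meson add_mono norm_triangle_ineq order_trans)
    moreover have "(\<lambda>z. g z + h z) \<in> borel_measurable borel"
      using g h by (auto simp: P_def)
    ultimately show ?thesis
      using g h int1[OF g] int1[OF h] int2[OF g] int2[OF h]
      unfolding P_def by (auto simp: distrib_left distrib_right)
  qed
  have scale: "P (\<lambda>z. a * h z)" if h: "P h" for h a
  proof -
    from h obtain C where C: "\<forall>z. norm z = 1 \<longrightarrow> norm (h z) \<le> C"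
      by (auto simp: P_def)
    then have "\<forall>z. norm z = 1 \<longrightarrow> norm (a * h z) \<le> norm a * C"
      by (auto simp: norm_mult intro!: mult_left_mono)
    moreover have "(\<lambda>z. a * h z) \<in> borel_measurable borel"
      using h by (auto simp: P_def)
    moreover have "u z * (a * h (T z) * w) = a * (u z * (h (T z) * w))"
       "v z * (a * h z * w) = a * (v z * (h z * w))" for z w
      by (simp_all add: mult_ac)
    ultimately show ?thesis
      using h unfolding P_def by (simp only:) auto
  qed
  have z: "P (\<lambda>z. h z * z)" if h: "P h" for h
  proof -
    have "(\<lambda>z. h z * z) \<in> borel_measurable borel" using h by (auto simp: P_def)
    moreover have "\<exists>C. \<forall>z. norm z = 1 \<longrightarrow> norm (h z * z) \<le> C"
      using h by (auto simp: P_def norm_mult)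
    moreover have "u z * (h (T z) * T z * (T z ^ j * cnj (T z) ^ k)) = u z * (h (T z) * (T z ^ Suc j * cnj (T z) ^ k))"
      "v z * (h z * z * (z ^ j * cnj z ^ k)) = v z * (h z * (z ^ Suc j * cnj z ^ k))" for z j k
      by (simp_all add: mult_ac)
    ultimately show ?thesis
      using h unfolding P_def by (simp only:) auto
  qed
  have cnj_z: "P (\<lambda>z. h z * cnj z)" if h: "P h" for h
  proof -
    have "(\<lambda>z. h z * cnj z) \<in> borel_measurable borel" using h by (auto simp: P_def)
    moreover have "\<exists>C. \<forall>z. norm z = 1 \<longrightarrow> norm (h z * cnj z) \<le> C"
      using h by (auto simp: P_def norm_mult)
    moreover have "u z * (h (T z) * cnj (T z) * (T z ^ j * cnj (T z) ^ k)) = u z * (h (T z) * (T z ^ j * cnj (T z) ^ Suc k))"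
      "v z * (h z * cnj z * (z ^ j * cnj z ^ k)) = v z * (h z * (z ^ j * cnj z ^ Suc k))" for z j k
      by (simp_all add: mult_ac)
    ultimately show ?thesis
      using h unfolding P_def by (simp only:) auto
  qed
  have "P (\<lambda>z. 1 * of_real (p z))"
  proof (rule real_polynomial_function_induct_mult[OF p, where P = P and u = "\<lambda>_. 1" and g = "\<lambda>z. z"])
    show "P (\<lambda>_. 1)" using eq by (auto simp: P_def)
  next
    fix h assume h: "P h"
    have "P (\<lambda>z. (1/2) * (h z * z) + (1/2) * (h z * cnj z))"
      by (intro add scale z cnj_z h)
    also have "(\<lambda>z. (1/2) * (h z * z) + (1/2) * (h z * cnj z)) = (\<lambda>z. h z * of_real (Re z))"
      by (auto simp: fun_eq_iff complex_eq_iff field_simps)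
    finally show "P (\<lambda>z. h z * of_real (Re z))" .
    have "P (\<lambda>z. (-\<i>/2) * (h z * z) + (\<i>/2) * (h z * cnj z))"
      by (intro add scale z cnj_z h)
    also have "(\<lambda>z. (-\<i>/2) * (h z * z) + (\<i>/2) * (h z * cnj z)) = (\<lambda>z. h z * of_real (Im z))"
      by (auto simp: fun_eq_iff complex_eq_iff field_simps)
    finally show "P (\<lambda>z. h z * of_real (Im z))" .
  qed (fact add scale)+
  then have "\<forall>j k. (LINT z|circle_measure. u z * (of_real (p (T z)) * (T z ^ j * cnj (T z) ^ k))) =
             (LINT z|circle_measure. v z * (of_real (p z) * (z ^ j * cnj z ^ k)))"
    by (simp add: P_def)
  from this[rule_format, of 0 0] show ?thesis by simp
qed

lemma integral_continuous_of_factor: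
  fixes \<phi> :: "complex \<Rightarrow> real"
  assumes \<phi>: "continuous_on UNIV \<phi>"
  shows "(LINT z|circle_measure. u z * of_real (\<phi> (T z))) = (LINT z|circle_measure. v z * of_real (\<phi> z))"
proof (rule complex_eqI_small[where K = "2 * B"])
  fix e :: real assume e: "e > 0"
  obtain p where p: "real_polynomial_function p" and pe: "\<And>z. z \<in> sphere 0 1 \<Longrightarrow> \<bar>\<phi> z - p z\<bar> < e"
    using Stone_Weierstrass_real_polynomial_function[OF compact_sphere continuous_on_subset[OF \<phi>] e]
    by (metis subset_UNIV)
  have [measurable]: "\<phi> \<in> borel_measurable borel" "p \<in> borel_measurable borel"
    using \<phi> p by (auto intro!: borel_measurable_continuous_onI continuous_on_polymonial_function
                         simp: real_polynomial_function_eq)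
  define g where "g z = \<phi> z - p z" for z
  have [measurable]: "g \<in> borel_measurable borel" unfolding g_def by measurable
  have ge: "\<bar>g z\<bar> \<le> e" if "norm z = 1" for z
    using pe[of z] that by (simp add: g_def)
  obtain C where C: "\<And>z. z \<in> sphere 0 1 \<Longrightarrow> norm (p z) \<le> C"
    using compact_imp_bounded[OF compact_continuous_image[OF continuous_on_polymonial_function compact_sphere]]
      p unfolding bounded_iff real_polynomial_function_eq by (metis image_eqI)
  have mT: "(\<lambda>z. of_real (h (T z)) :: complex) \<in> borel_measurable circle_measure"
    and mI: "(\<lambda>z. of_real (h z) :: complex) \<in> borel_measurable circle_measure"
    if [measurable]: "h \<in> borel_measurable borel" for h :: "complex \<Rightarrow> real"
    by (rule borel_sphere_map borel_measurable_circleI; measurable)+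
  have int1: "integrable circle_measure (\<lambda>z. u z * of_real (h (T z)))"
    and int2: "integrable circle_measure (\<lambda>z. v z * of_real (h z))"
    and le1: "norm (LINT z|circle_measure. u z * of_real (h (T z))) \<le> B * D"
    and le2: "norm (LINT z|circle_measure. v z * of_real (h z)) \<le> B * D"
    if h: "h \<in> borel_measurable borel" and D: "\<And>z. norm z = 1 \<Longrightarrow> \<bar>h z\<bar> \<le> D" for h :: "complex \<Rightarrow> real" and D
  proof -
    note [measurable] = mT[OF h] mI[OF h]
    have b: "norm z = 1 \<Longrightarrow> norm (u z * of_real (h (T z))) \<le> B * D"
         "norm z = 1 \<Longrightarrow> norm (v z * of_real (h z)) \<le> B * D" for z
      using multiplier_bound_nonneg by (auto simp: norm_mult norm_sphere_map intro!: mult_mono ub vb D)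
    show i: "integrable circle_measure (\<lambda>z. u z * of_real (h (T z)))"
      "integrable circle_measure (\<lambda>z. v z * of_real (h z))"
      by (rule integrable_circle_bounded[where B = "B * D"]; use b in force)+
    show "norm (LINT z|circle_measure. u z * of_real (h (T z))) \<le> B * D"
      by (rule order_trans[OF integral_norm_bound], rule circle.integral_le_const)
         (use b i in \<open>auto intro!: AE_I2\<close>)
    show "norm (LINT z|circle_measure. v z * of_real (h z)) \<le> B * D"
      by (rule order_trans[OF integral_norm_bound], rule circle.integral_le_const)
         (use b i in \<open>auto intro!: AE_I2\<close>)
  qed
  have C': "\<bar>p z\<bar> \<le> C" if "norm z = 1" for z using C[of z] that by simp
  have "(LINT z|circle_measure. u z * of_real (\<phi> (T z))) =
      (LINT z|circle_measure. u z * of_real (p (T z)) + u z * of_real (g (T z)))"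
    by (simp add: g_def algebra_simps)
  also have "\<dots> = (LINT z|circle_measure. u z * of_real (p (T z))) + (LINT z|circle_measure. u z * of_real (g (T z)))"
    by (intro Bochner_Integration.integral_add int1[of p C] int1[of g e]) (auto intro: C' ge)
  finally have 1: "(LINT z|circle_measure. u z * of_real (\<phi> (T z))) = \<dots>" .
  have "(LINT z|circle_measure. v z * of_real (\<phi> z)) =
      (LINT z|circle_measure. v z * of_real (p z) + v z * of_real (g z))"
    by (simp add: g_def algebra_simps)
  also have "\<dots> = (LINT z|circle_measure. v z * of_real (p z)) + (LINT z|circle_measure. v z * of_real (g z))"
    by (intro Bochner_Integration.integral_add int2[of p C] int2[of g e]) (auto intro: C' ge)
  finally have 2: "(LINT z|circle_measure. v z * of_real (\<phi> z)) = \<dots>" .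
  have "norm ((LINT z|circle_measure. u z * of_real (g (T z))) - (LINT z|circle_measure. v z * of_real (g z))) \<le> B * e + B * e"
    by (intro order_trans[OF norm_triangle_ineq4] add_mono le1 le2) (auto intro: ge)
  then show "norm ((LINT z|circle_measure. u z * of_real (\<phi> (T z))) - (LINT z|circle_measure. v z * of_real (\<phi> z))) \<le> 2 * B * e"
    unfolding 1 2 integral_polynomial_of_factor[OF p] by simp
qed

lemma multiplier_indicator_bounds:
  assumes "norm z = 1"
  shows "norm (u z * indicator A (T z)) \<le> B" "norm (v z * indicator A z) \<le> B"
  using ub[OF assms] vb[OF assms] multiplier_bound_nonneg by (auto simp: norm_mult split: split_indicator)

lemma integral_indicator_of_factor:
  assumes "A \<in> sets borel"
  shows "(LINT z|circle_measure. u z * indicator A (T z)) = (LINT z|circle_measure. v z * indicator A z)"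
proof -
  have mT: "(\<lambda>z. indicator X (T z) :: complex) \<in> borel_measurable circle_measure"
    and mI: "(\<lambda>z. indicator X z :: complex) \<in> borel_measurable circle_measure"
    if [measurable]: "X \<in> sets borel" for X
    by (rule borel_sphere_map borel_measurable_circleI; measurable)+
  have int: "integrable circle_measure (\<lambda>z. u z * indicator X (T z))"
       "integrable circle_measure (\<lambda>z. v z * indicator X z)" if X: "X \<in> sets borel" for X
  proof -
    note [measurable] = mT[OF X] mI[OF X]
    show "integrable circle_measure (\<lambda>z. u z * indicator X (T z))"
       "integrable circle_measure (\<lambda>z. v z * indicator X z)"
      by (rule integrable_circle_bounded[where B = B]; use multiplier_indicator_bounds in force)+
  qed
  have "Int_stable (Collect closed :: complex set set)"
    by (auto simp: Int_stable_def)
  moreover have "Collect closed \<subseteq> Pow (UNIV :: complex set)"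
    by simp
  moreover have "A \<in> sigma_sets UNIV (Collect closed)"
    using assms by (simp add: borel_eq_closed)
  ultimately show ?thesis
  proof (induction rule: sigma_sets_induct_disjoint)
    case (basic X)
    then have [measurable]: "closed X" by simp
    show ?case
    proof (cases "X = {}")
      case False
      have pl: "(\<lambda>z. of_real (plateau X k (T z)) :: complex) \<in> borel_measurable circle_measure" 
        "(\<lambda>z. of_real (plateau X k z) :: complex) \<in> borel_measurable circle_measure" for k
        by (rule borel_sphere_map borel_measurable_circleI; measurable)+
      have ind: "(\<lambda>k. of_real (plateau X k z) :: complex) \<longlonglongrightarrow> indicator X z" for z
        using tendsto_of_real[OF plateau_tendsto_indicator[OF \<open>closed X\<close> False, of z], where 'a = complex]
        by (simp add: of_real_indicator)
      note [measurable] = pl mT[of X] mI[of X]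
      have le: "norm (of_real (plateau X k z) :: complex) \<le> 1" for k z
        using plateau_bounds[of X k z] by simp
      have "(\<lambda>k. LINT z|circle_measure. u z * of_real (plateau X k (T z))) \<longlonglongrightarrow> (LINT z|circle_measure. u z * indicator X (T z))"
      proof (rule integral_dominated_convergence[where w = "\<lambda>_. B"])
        show "AE z in circle_measure. (\<lambda>k. u z * of_real (plateau X k (T z))) \<longlonglongrightarrow> u z * indicator X (T z)"
          by (intro AE_I2 tendsto_intros ind)
        show "AE z in circle_measure. norm (u z * of_real (plateau X k (T z))) \<le> B" for k
          using mult_mono[OF ub le multiplier_bound_nonneg, of _ k] by (intro AE_I2) (simp add: norm_mult)
      qed (auto intro!: borel_measurable_times u pl mT)
      moreover have "(\<lambda>k. LINT z|circle_measure. v z * of_real (plateau X k z)) \<longlonglongrightarrow> (LINT z|circle_measure. v z * indicator X z)"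
      proof (rule integral_dominated_convergence[where w = "\<lambda>_. B"])
        show "AE z in circle_measure. (\<lambda>k. v z * of_real (plateau X k z)) \<longlonglongrightarrow> v z * indicator X z"
          by (intro AE_I2 tendsto_intros ind)
        show "AE z in circle_measure. norm (v z * of_real (plateau X k z)) \<le> B" for k
          using mult_mono[OF vb le multiplier_bound_nonneg, of _ k] by (intro AE_I2) (simp add: norm_mult)
      qed (auto intro!: borel_measurable_times v pl mI)
      ultimately show ?thesis
        unfolding integral_continuous_of_factor[OF continuous_plateau] by (rule LIMSEQ_unique)
    qed simp
  next
    case empty then show ?case by simp
  next
    case (compl X)
    then have X: "X \<in> sets borel" by (simp add: borel_eq_closed)
    have c: "indicator (UNIV - X) z = (1 - indicator X z :: complex)" for z :: complex
      by (simp split: split_indicator)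
    have 1: "(LINT z|circle_measure. u z) = (LINT z|circle_measure. v z)"
      using eq[of 0 0] by simp
    have "integrable circle_measure u" "integrable circle_measure v"
      by (rule integrable_circle_bounded[where B = B]; use ub vb in force)+
    then show ?case using compl.IH int[OF X] 1
      unfolding c by (simp add: right_diff_distrib)
  next
    case (union X)
    then have X: "X i \<in> sets borel" for i by (auto simp: borel_eq_closed)
    have sums: "(\<lambda>i. indicator (X i) z :: complex) sums indicator (\<Union>i. X i) z" for z
    proof -
      have "(\<lambda>i. indicator (X i) z :: real) sums indicator (\<Union>i. X i) z"
        using \<open>disjoint_family X\<close> by (intro indicator_sums) (auto simp: disjoint_family_on_def)
      from sums_of_real[OF this, where 'a = complex] show ?thesis
        by (simp add: of_real_indicator)
    qed
    have part: "(\<Sum>i<n. indicator (X i) z :: complex) = indicator (\<Union>i<n. X i) z" for n z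
      using \<open>disjoint_family X\<close> by (subst indicator_UN_disjoint) (auto simp: disjoint_family_on_def)
    have U: "(\<Union>i<n. X i) \<in> sets borel" "(\<Union>i. X i) \<in> sets borel" for n using X by auto
    note [measurable] = mT[OF U(1)] mI[OF U(1)] mT[OF U(2)] mI[OF U(2)] mT[OF X] mI[OF X]
    have "(\<lambda>n. LINT z|circle_measure. u z * (\<Sum>i<n. indicator (X i) (T z))) \<longlonglongrightarrow> (LINT z|circle_measure. u z * indicator (\<Union>i. X i) (T z))"
      using sums[unfolded sums_def]
      by (intro integral_dominated_convergence[where w = "\<lambda>_. B"] AE_I2 tendsto_intros)
         (auto simp: part intro: multiplier_indicator_bounds)
    moreover have "(\<lambda>n. LINT z|circle_measure. v z * (\<Sum>i<n. indicator (X i) z)) \<longlonglongrightarrow> (LINT z|circle_measure. v z * indicator (\<Union>i. X i) z)"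
      using sums[unfolded sums_def]
      by (intro integral_dominated_convergence[where w = "\<lambda>_. B"] AE_I2 tendsto_intros)
         (auto simp: part intro: multiplier_indicator_bounds)
    moreover have "(LINT z|circle_measure. u z * (\<Sum>i<n. indicator (X i) (T z))) = (LINT z|circle_measure. v z * (\<Sum>i<n. indicator (X i) z))" for n
      unfolding sum_distrib_left
      by (subst (1 2) Bochner_Integration.integral_sum) (use union.IH int[OF X] in auto)
    ultimately show ?case by (simp add: LIMSEQ_unique)
  qed
qed

text \<open>
  The conclusion says that \<open>v \<circ> T\<close> is the conditional expectation of \<open>u\<close> given \<open>T\<close>.  It extends
  the equality of the Fourier coefficients of \<open>u\<close> against \<open>T\<close> and of \<open>v\<close>: from polynomials to
  continuous functions by uniform approximation, to closed sets by monotone limits, to Borel sets by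
  a Dynkin system argument, and finally to integrable functions.
\<close>

lemma integral_of_factor:
  fixes G :: "complex \<Rightarrow> complex"
  assumes pres: "distr circle_measure circle_measure T = circle_measure"
    and G: "integrable circle_measure G"
  shows "(LINT z|circle_measure. u z * G (T z)) = (LINT z|circle_measure. v z * G z)"
proof -
  have intT: "integrable circle_measure (\<lambda>z. g (T z))" if "integrable circle_measure g" for g :: "complex \<Rightarrow> complex"
    using that integrable_distr_eq[OF T, of g] unfolding pres by (auto dest: borel_measurable_integrable)
  have int1: "integrable circle_measure (\<lambda>z. u z * g (T z))"
    and int2: "integrable circle_measure (\<lambda>z. v z * g z)" if g: "integrable circle_measure g" for g
  proof -
    note [measurable] = borel_measurable_integrable[OF g] borel_measurable_integrable[OF intT[OF g]]
    show "integrable circle_measure (\<lambda>z. u z * g (T z))"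
      by (rule Bochner_Integration.integrable_bound[OF integrable_mult_right[OF intT[OF g], of "of_real B"]])
         (use ub multiplier_bound_nonneg in \<open>auto intro!: AE_I2 mult_right_mono simp: norm_mult\<close>)
    show "integrable circle_measure (\<lambda>z. v z * g z)"
      by (rule Bochner_Integration.integrable_bound[OF integrable_mult_right[OF g, of "of_real B"]])
         (use vb multiplier_bound_nonneg in \<open>auto intro!: AE_I2 mult_right_mono simp: norm_mult\<close>)
  qed
  show ?thesis
    using G
  proof (induction rule: integrable_induct)
    case (base A c)
    have "u z * indicator A (T z) *\<^sub>R c = c * (u z * indicator A (T z))"
      "v z * indicator A z *\<^sub>R c = c * (v z * indicator A z)" for z
      by (auto split: split_indicator)
    then show ?case
      using integral_indicator_of_factor[OF sets_circle_imp_borel[OF base(1)]] by simp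
  next
    case (add f g)
    then show ?case using int1 int2 by (simp add: distrib_left)
  next
    case (lim f s)
    note [measurable] = borel_measurable_integrable[OF lim(1)] borel_measurable_integrable[OF intT[OF lim(1)]]
       borel_measurable_integrable[OF lim(4)] borel_measurable_integrable[OF intT[OF lim(4)]]
    have "(\<lambda>i. LINT z|circle_measure. u z * s i (T z)) \<longlonglongrightarrow> (LINT z|circle_measure. u z * f (T z))"
    proof (rule integral_dominated_convergence[where w = "\<lambda>z. norm (u z * (2 * f (T z)))"])
      show "integrable circle_measure (\<lambda>z. norm (u z * (2 * f (T z))))"
        using integrable_norm[OF integrable_mult_right[OF int1[OF lim(4)], of 2]] by (simp add: mult_ac)
      show "AE z in circle_measure. (\<lambda>i. u z * s i (T z)) \<longlonglongrightarrow> u z * f (T z)"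
        using lim(2) norm_sphere_map by (intro AE_I2 tendsto_intros) auto
      show "AE z in circle_measure. norm (u z * s i (T z)) \<le> norm (u z * (2 * f (T z)))" for i
        using lim(3) norm_sphere_map by (intro AE_I2) (auto simp: norm_mult intro!: mult_left_mono)
    qed measurable
    moreover have "(\<lambda>i. LINT z|circle_measure. v z * s i z) \<longlonglongrightarrow> (LINT z|circle_measure. v z * f z)"
    proof (rule integral_dominated_convergence[where w = "\<lambda>z. norm (v z * (2 * f z))"])
      show "integrable circle_measure (\<lambda>z. norm (v z * (2 * f z)))"
        using integrable_norm[OF integrable_mult_right[OF int2[OF lim(4)], of 2]] by (simp add: mult_ac)
      show "AE z in circle_measure. (\<lambda>i. v z * s i z) \<longlonglongrightarrow> v z * f z"
        using lim(2) by (intro AE_I2 tendsto_intros) auto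
      show "AE z in circle_measure. norm (v z * s i z) \<le> norm (v z * (2 * f z))" for i
        using lim(3) by (intro AE_I2) (auto simp: norm_mult intro!: mult_left_mono)
    qed measurable
    ultimately show ?case using lim(5) by (simp add: LIMSEQ_unique)
  qed
qed

end

text \<open>
  Two Borel probability measures on the circle with equal Fourier coefficients coincide.
\<close>

lemma circle_measure_preservedI:
  assumes T: "T \<in> circle_measure \<rightarrow>\<^sub>M circle_measure"
    and eq: "\<And>j k. (LINT z|circle_measure. T z ^ j * cnj (T z) ^ k) =
                   (LINT z|circle_measure. z ^ j * cnj z ^ k)"
  shows "distr circle_measure circle_measure T = circle_measure"
proof (rule measure_eqI)
  fix A assume "A \<in> sets (distr circle_measure circle_measure T)"
  then have A: "A \<in> sets circle_measure" by simp
  have [simp]: "T -` A \<inter> sphere 0 1 \<in> sets circle_measure"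
    using measurable_sets[OF T A] by simp
  have "(LINT z|circle_measure. 1 * indicator A (T z)) = (LINT z|circle_measure. 1 * (indicator A z :: complex))"
    by (rule integral_indicator_of_factor[OF T, where B = 1])
       (use eq sets_circle_imp_borel[OF A] in auto)
  moreover have "(LINT z|circle_measure. indicator A (T z) :: complex) = of_real (measure circle_measure (T -` A \<inter> sphere 0 1))"
  proof -
    have "(LINT z|circle_measure. indicator A (T z) :: complex) = (LINT z|circle_measure. of_real (indicator (T -` A \<inter> sphere 0 1) z))"
      by (intro Bochner_Integration.integral_cong) (auto split: split_indicator)
    then show ?thesis by (simp add: Int_absorb1 Int_assoc)
  qed
  moreover have "(LINT z|circle_measure. indicator A z :: complex) = of_real (measure circle_measure A)"
  proof -
    have "(LINT z|circle_measure. indicator A z :: complex) = (LINT z|circle_measure. of_real (indicator A z))"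
      by (intro Bochner_Integration.integral_cong) (auto split: split_indicator)
    then show ?thesis using sets.sets_into_space[OF A] by (simp add: Int_absorb2)
  qed
  ultimately have "measure circle_measure (T -` A \<inter> sphere 0 1) = measure circle_measure A"
    by simp
  then show "emeasure (distr circle_measure circle_measure T) A = emeasure circle_measure A"
    using T A by (simp add: emeasure_distr circle.emeasure_eq_measure)
qed simp

section \<open>From characteristic functions to weak convergence in the plane\<close>

lemma weak_limit_closed:
  fixes M :: "nat \<Rightarrow> complex measure" and \<gamma> :: "complex measure"
  assumes M: "\<And>n. prob_space (M n)" "\<And>n. sets (M n) = sets borel"
    and \<gamma>: "prob_space \<gamma>" "sets \<gamma> = sets borel"
    and lim: "\<And>\<phi> :: complex \<Rightarrow> real. continuous_on UNIV \<phi> \<Longrightarrow> (\<And>z. 0 \<le> \<phi> z \<and> \<phi> z \<le> 1) \<Longrightarrow>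
               (\<lambda>n. LINT z|M n. \<phi> z) \<longlonglongrightarrow> (LINT z|\<gamma>. \<phi> z)"
    and C: "closed C" and e: "e > 0"
  shows "\<forall>\<^sub>F n in sequentially. measure (M n) C < measure \<gamma> C + e"
proof (cases "C = {}")
  case True then show ?thesis using e by simp
next
  case False
  interpret \<gamma>: prob_space \<gamma> by fact
  have [measurable]: "C \<in> sets borel" using C by simp
  have [measurable_cong]: "sets \<gamma> = sets borel" "sets (M n) = sets borel" for n by fact+
  have "plateau C k \<in> borel_measurable \<gamma>" "(indicator C :: complex \<Rightarrow> real) \<in> borel_measurable \<gamma>" for k
    by measurable
  then have "(\<lambda>k. LINT z|\<gamma>. plateau C k z) \<longlonglongrightarrow> (LINT z|\<gamma>. indicator C z)"
    by (intro integral_dominated_convergence[where w = "\<lambda>_. 1"])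
       (use C False plateau_bounds in \<open>auto intro!: plateau_tendsto_indicator AE_I2\<close>)
  also have "(LINT z|\<gamma>. indicator C z) = measure \<gamma> C"
    using C \<gamma>(2) by (simp add: sets_eq_imp_space_eq[OF \<gamma>(2)])
  finally have "\<forall>\<^sub>F k in sequentially. (LINT z|\<gamma>. plateau C k z) < measure \<gamma> C + e"
    using e by (intro order_tendstoD) auto
  then obtain k where k: "(LINT z|\<gamma>. plateau C k z) < measure \<gamma> C + e"
    by (meson eventually_happens trivial_limit_sequentially)
  have "(\<lambda>n. LINT z|M n. plateau C k z) \<longlonglongrightarrow> (LINT z|\<gamma>. plateau C k z)"
    by (intro lim continuous_plateau) (use plateau_bounds in auto)
  from order_tendstoD(2)[OF this k] show ?thesis
  proof eventually_elim
    case (elim n)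
    interpret Mn: prob_space "M n" by (rule M)
    have "measure (M n) C = (LINT z|M n. indicator C z)"
      using C M(2)[of n] by (simp add: sets_eq_imp_space_eq[OF M(2)])
    also have "\<dots> \<le> (LINT z|M n. plateau C k z)"
    proof (rule integral_mono)
      show "integrable (M n) (plateau C k)"
        using plateau_bounds by (intro Mn.integrable_const_bound[where B = 1]) (auto intro!: AE_I2)
      show "integrable (M n) (indicator C :: complex \<Rightarrow> real)"
        by (intro Mn.integrable_const_bound[where B = 1]) (auto split: split_indicator)
      show "indicator C z \<le> plateau C k z" for z
        using plateau_bounds[of C k z] by (auto simp: plateau_eq_1 split: split_indicator)
    qed
    finally show ?case using elim by simp
  qed
qed

text \<open>
  The upper bound for closed sets, applied to the closures of \<open>K\<close> and of its complement, gives both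
  an upper and a lower bound, which agree because the frontier of \<open>K\<close> carries no mass.
\<close>

lemma weak_limit_continuity_set:
  fixes M :: "nat \<Rightarrow> complex measure" and \<gamma> :: "complex measure"
  assumes M: "\<And>n. prob_space (M n)" "\<And>n. sets (M n) = sets borel"
    and \<gamma>: "prob_space \<gamma>" "sets \<gamma> = sets borel"
    and lim: "\<And>\<phi> :: complex \<Rightarrow> real. continuous_on UNIV \<phi> \<Longrightarrow> (\<And>z. 0 \<le> \<phi> z \<and> \<phi> z \<le> 1) \<Longrightarrow>
               (\<lambda>n. LINT z|M n. \<phi> z) \<longlonglongrightarrow> (LINT z|\<gamma>. \<phi> z)"
    and K: "K \<in> sets borel" and fr: "measure \<gamma> (frontier K) = 0"
  shows "(\<lambda>n. measure (M n) K) \<longlonglongrightarrow> measure \<gamma> K"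
proof -
  interpret \<gamma>: prob_space \<gamma> by fact
  have sp: "space \<gamma> = UNIV" "space (M n) = UNIV" for n
    using sets_eq_imp_space_eq[OF \<gamma>(2)] sets_eq_imp_space_eq[OF M(2)] by auto
  have upper: "\<forall>\<^sub>F n in sequentially. measure (M n) L < measure \<gamma> L + e"
    if L: "L \<in> sets borel" and frL: "measure \<gamma> (frontier L) = 0" and e: "e > 0" for L e
  proof -
    have "measure \<gamma> (closure L) \<le> measure \<gamma> (L \<union> frontier L)"
      using L \<gamma>(2) by (intro \<gamma>.finite_measure_mono) (auto simp: frontier_def dest: subsetD[OF interior_subset])
    also have "\<dots> \<le> measure \<gamma> L + measure \<gamma> (frontier L)"
      using L \<gamma>(2) by (intro measure_Un_le) auto
    finally have le: "measure \<gamma> (closure L) \<le> measure \<gamma> L" using frL by simp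
    have "\<forall>\<^sub>F n in sequentially. measure (M n) (closure L) < measure \<gamma> (closure L) + e"
      by (rule weak_limit_closed[OF M \<gamma> lim closed_closure e])
    then show ?thesis
    proof eventually_elim
      case (elim n)
      interpret Mn: prob_space "M n" by (rule M)
      have "measure (M n) L \<le> measure (M n) (closure L)"
        using M(2)[of n] by (intro Mn.finite_measure_mono closure_subset) auto
      with elim le show ?case by simp
    qed
  qed
  have compl: "measure (M n) (- K) = 1 - measure (M n) K" "measure \<gamma> (- K) = 1 - measure \<gamma> K" for n
  proof -
    interpret Mn: prob_space "M n" by (rule M)
    show "measure (M n) (- K) = 1 - measure (M n) K"
      using Mn.prob_compl[of K] K M(2)[of n] by (simp add: sp Compl_eq_Diff_UNIV)
    show "measure \<gamma> (- K) = 1 - measure \<gamma> K"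
      using \<gamma>.prob_compl[of K] K \<gamma>(2) by (simp add: sp Compl_eq_Diff_UNIV)
  qed
  show ?thesis
  proof (rule tendstoI)
    fix e :: real assume e: "e > 0"
    have "- K \<in> sets borel" "measure \<gamma> (frontier (- K)) = 0"
      using K fr by (auto simp: frontier_complement)
    from upper[OF K fr e] upper[OF this e]
    show "\<forall>\<^sub>F n in sequentially. dist (measure (M n) K) (measure \<gamma> K) < e"
      by eventually_elim (auto simp: compl dist_real_def abs_less_iff)
  qed
qed

text \<open>
  Chebyshev's inequality, in the form needed for tightness.
\<close>

lemma tail_bound:
  fixes \<nu> :: "complex measure"
  assumes \<nu>: "prob_space \<nu>" "sets \<nu> = sets borel"
    and int: "integrable \<nu> (\<lambda>w. (norm w)\<^sup>2)" and le: "(LINT w|\<nu>. (norm w)\<^sup>2) \<le> V" and R: "R > 0"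
    and \<phi>: "\<phi> \<in> borel_measurable borel" "\<And>w. norm w \<le> R \<Longrightarrow> \<bar>\<phi> w\<bar> \<le> e" "\<And>w. \<bar>\<phi> w\<bar> \<le> B"
    and e: "0 \<le> e"
  shows "\<bar>LINT w|\<nu>. \<phi> w\<bar> \<le> e + B * V / R\<^sup>2"
proof -
  interpret \<nu>: prob_space \<nu> by fact
  have [measurable_cong]: "sets \<nu> = sets borel" by fact
  have B: "0 \<le> B" using \<phi>(3)[of 0] by linarith
  have bd: "\<bar>\<phi> w\<bar> \<le> e + B / R\<^sup>2 * (norm w)\<^sup>2" for w
  proof (cases "norm w \<le> R")
    case True
    then show ?thesis using \<phi>(2)[of w] B by (simp add: add_increasing2)
  next
    case False
    then have "R\<^sup>2 \<le> (norm w)\<^sup>2" using R by (intro power_mono) auto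
    then have "B * 1 \<le> B * ((norm w)\<^sup>2 / R\<^sup>2)" using R B by (intro mult_left_mono) auto
    then show ?thesis using \<phi>(3)[of w] e by simp
  qed
  have "\<bar>LINT w|\<nu>. \<phi> w\<bar> \<le> (LINT w|\<nu>. \<bar>\<phi> w\<bar>)" by (rule integral_abs_bound)
  also have "\<dots> \<le> (LINT w|\<nu>. e + B / R\<^sup>2 * (norm w)\<^sup>2)"
  proof (rule integral_mono)
    show "integrable \<nu> (\<lambda>w. \<bar>\<phi> w\<bar>)"
      using \<phi>(3) measurable_cong_sets[OF \<nu>(2) refl] \<phi>(1)
      by (intro \<nu>.integrable_const_bound[where B = B]) (auto intro!: borel_measurable_abs)
  qed (use int bd in auto)
  also have "\<dots> = e + B / R\<^sup>2 * (LINT w|\<nu>. (norm w)\<^sup>2)"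
    using int by (simp add: \<nu>.prob_space)
  also have "\<dots> \<le> e + B / R\<^sup>2 * V"
    using le B by (intro add_left_mono mult_left_mono) auto
  finally show ?thesis by simp
qed

definition character :: "complex \<Rightarrow> complex \<Rightarrow> complex" where
  "character t w = cis (Re (cnj t * w))"

lemma character_add: "character (s + t) w = character s w * character t w"
  by (simp add: character_def cis_mult algebra_simps)

lemma character_0 [simp]: "character 0 w = 1"
  by (simp add: character_def)

lemma norm_character [simp]: "norm (character t w) = 1"
  by (simp add: character_def)

lemma borel_measurable_character [measurable]: "character t \<in> borel_measurable borel"
  unfolding character_def by (intro borel_measurable_continuous_onI continuous_intros)

text \<open>
  Instead of inverting Fourier transforms, a bounded continuous function \<open>\<phi>\<close> is approximated, on a large
  disc of radius \<open>R\<close>, by a polynomial in \<open>sin (Re w / R)\<close> and \<open>sin (Im w / R)\<close>.  Such a polynomial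
  is a linear combination of characters, so its integrals converge, and it is bounded on the
  whole plane by almost the same constant as \<open>\<phi>\<close>, so that the bounded second moments control what happens
  outside the disc.
\<close>

lemma continuity_theorem_complex:
  fixes M :: "nat \<Rightarrow> complex measure" and \<gamma> :: "complex measure"
  assumes M: "\<And>n. prob_space (M n)" "\<And>n. sets (M n) = sets borel"
    and \<gamma>: "prob_space \<gamma>" "sets \<gamma> = sets borel"
    and lim: "\<And>t. (\<lambda>n. LINT w|M n. character t w) \<longlonglongrightarrow> (LINT w|\<gamma>. character t w)"
    and Mint: "\<And>n. integrable (M n) (\<lambda>w. (norm w)\<^sup>2)" and MV: "\<And>n. (LINT w|M n. (norm w)\<^sup>2) \<le> V"
    and \<gamma>int: "integrable \<gamma> (\<lambda>w. (norm w)\<^sup>2)" and \<gamma>V: "(LINT w|\<gamma>. (norm w)\<^sup>2) \<le> V"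
    and \<phi>: "continuous_on UNIV (\<phi> :: complex \<Rightarrow> real)" "\<And>z. \<bar>\<phi> z\<bar> \<le> 1"
  shows "(\<lambda>n. LINT z|M n. \<phi> z) \<longlonglongrightarrow> (LINT z|\<gamma>. \<phi> z)"
proof (rule tendstoI)
  fix e :: real assume e: "e > 0"
  interpret \<gamma>: prob_space \<gamma> by fact
  interpret Mn: prob_space "M n" for n by (rule M)
  have cong [measurable_cong]: "sets \<gamma> = sets borel" "sets (M n) = sets borel" for n by fact+
  have V: "V \<ge> 0" using \<gamma>V by (rule order_trans[rotated]) simp
  define d where "d = min 1 (e / 8)"
  have d: "0 < d" "d \<le> 1" "d \<le> e / 8" using e by (auto simp: d_def)
  \<comment> \<open>Chosen such that the part outside the disc, at most \<open>3 * V / R\<^sup>2\<close>, is at most \<open>e / 8\<close>.\<close>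
  define R where "R = sqrt (24 * (V + 1) / e)"
  have R: "R > 0" using V e by (simp add: R_def)
  have VR: "3 * V / R\<^sup>2 \<le> e / 8"
    using V e by (simp add: R_def field_simps)
  define g where "g w = Complex (sin (Re w / R)) (sin (Im w / R))" for w
  define \<psi> where "\<psi> w = \<phi> (Complex (R * arcsin (Re w)) (R * arcsin (Im w)))" for w
  define Q where "Q = cbox (Complex (-1) (-1)) (Complex 1 1)"
  have Q: "w \<in> Q \<longleftrightarrow> \<bar>Re w\<bar> \<le> 1 \<and> \<bar>Im w\<bar> \<le> 1" for w
    by (auto simp: Q_def in_cbox_complex_iff abs_le_iff)
  have contQ: "continuous_on Q (\<lambda>w. Complex (R * arcsin (Re w)) (R * arcsin (Im w)))"
    unfolding Complex_eq using Q
    by (intro continuous_intros continuous_on_arcsin) (auto simp: abs_le_iff)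
  have "continuous_on Q \<psi>"
    unfolding \<psi>_def by (rule continuous_on_compose2[OF \<phi>(1) contQ]) auto
  then obtain p where p: "real_polynomial_function p" and pd: "\<And>w. w \<in> Q \<Longrightarrow> \<bar>\<psi> w - p w\<bar> < d"
    using Stone_Weierstrass_real_polynomial_function[of Q \<psi> d] d by (auto simp: Q_def)
  define q where "q w = p (g w)" for w
  have gQ: "g w \<in> Q" for w by (simp add: Q g_def)
  have \<psi>1: "\<bar>\<psi> w\<bar> \<le> 1" for w by (simp add: \<psi>_def \<phi>(2))
  have q2: "\<bar>q w\<bar> \<le> 2" for w
    using pd[OF gQ[of w]] \<psi>1[of "g w"] d unfolding q_def by linarith
  have \<psi>g: "\<psi> (g w) = \<phi> w" if "norm w \<le> R" for w
  proof -
    have "\<bar>Re w / R\<bar> \<le> 1" "\<bar>Im w / R\<bar> \<le> 1"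
      using that abs_Re_le_cmod[of w] abs_Im_le_cmod[of w] R by (auto simp: abs_divide)
    then have "arcsin (sin (Re w / R)) = Re w / R" "arcsin (sin (Im w / R)) = Im w / R"
      using pi_ge_two by (intro arcsin_sin; linarith)+
    then show ?thesis using R by (simp add: \<psi>_def g_def)
  qed
  \<comment> \<open>On the disc \<open>\<bar>Re w / R\<bar> \<le> 1 < pi / 2\<close>, so that arcsin inverts the sine there.\<close>
  have close: "\<bar>\<phi> w - q w\<bar> \<le> d" if "norm w \<le> R" for w
    using pd[OF gQ[of w]] \<psi>g[OF that] by (simp add: q_def)
  have close3: "\<bar>\<phi> w - q w\<bar> \<le> 3" for w using q2[of w] \<phi>(2)[of w] by linarith
  have g_cont: "continuous_on UNIV g"
    unfolding g_def complex_eq using R by (intro continuous_intros) auto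
  have q_cont: "continuous_on UNIV q"
    unfolding q_def
    by (rule continuous_on_compose2[OF _ g_cont])
       (use p in \<open>auto simp: real_polynomial_function_eq intro: continuous_on_polymonial_function\<close>)
  have [measurable]: "\<phi> \<in> borel_measurable borel" "q \<in> borel_measurable borel"
    by (intro borel_measurable_continuous_onI \<phi> q_cont)+

  \<comment> \<open>Asking for convergence against every character makes the property stable under multiplication by
    characters, hence by sines.\<close>
  define P where "P h \<longleftrightarrow> h \<in> borel_measurable borel \<and> (\<exists>C. \<forall>w. norm (h w) \<le> C) \<and>
     (\<forall>t. (\<lambda>n. LINT w|M n. h w * character t w) \<longlonglongrightarrow> (LINT w|\<gamma>. h w * character t w))"
    for h :: "complex \<Rightarrow> complex"
  have int: "integrable \<gamma> (\<lambda>w. h w * character t w)" "integrable (M n) (\<lambda>w. h w * character t w)"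
    if "P h" for h t n
  proof -
    from that obtain C where [measurable]: "h \<in> borel_measurable borel" and C: "\<And>w. norm (h w) \<le> C"
      by (auto simp: P_def)
    show "integrable \<gamma> (\<lambda>w. h w * character t w)"
      using C by (intro \<gamma>.integrable_const_bound[where B = C]) (auto simp: norm_mult)
    show "integrable (M n) (\<lambda>w. h w * character t w)"
      using C by (intro Mn.integrable_const_bound[where B = C]) (auto simp: norm_mult)
  qed
  have add: "P (\<lambda>w. g w + h w)" if g: "P g" and h: "P h" for g h
  proof -
    from g h obtain C D where C: "\<forall>w. norm (g w) \<le> C" "\<forall>w. norm (h w) \<le> D"
      by (auto simp: P_def)
    then have "\<forall>w. norm (g w + h w) \<le> C + D"
      by (meson add_mono norm_triangle_ineq order_trans)
    then show ?thesis
      using g h int[OF g] int[OF h]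
      unfolding P_def by (auto simp: distrib_right intro!: tendsto_intros)
  qed
  have scale: "P (\<lambda>w. a * h w)" if h: "P h" for h a
  proof -
    from h obtain C where C: "\<forall>w. norm (h w) \<le> C" by (auto simp: P_def)
    then have "\<forall>w. norm (a * h w) \<le> norm a * C" by (auto simp: norm_mult intro!: mult_left_mono)
    then show ?thesis
      using h unfolding P_def by (auto simp: mult.assoc intro!: tendsto_intros)
  qed
  have char: "P (\<lambda>w. h w * character s w)" if h: "P h" for h s
    using h unfolding P_def
    by (auto simp: mult.assoc norm_mult simp flip: character_add)
  have sin_char: "of_real (sin (Re (cnj s * w))) = (-\<i>/2) * character s w + (\<i>/2) * character (-s) w" for s w
  proof -
    have "character (-s) w = cnj (character s w)" by (simp add: character_def cis_cnj)
    then show ?thesis by (simp add: complex_eq_iff) (simp add: character_def)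
  qed
  have sin: "P (\<lambda>w. h w * of_real (sin (Re (cnj s * w))))" if h: "P h" for h s
  proof -
    have "P (\<lambda>w. (-\<i>/2) * (h w * character s w) + (\<i>/2) * (h w * character (-s) w))"
      by (intro add scale char h)
    also have "(\<lambda>w. (-\<i>/2) * (h w * character s w) + (\<i>/2) * (h w * character (-s) w)) =
        (\<lambda>w. h w * of_real (sin (Re (cnj s * w))))"
      unfolding sin_char by (simp add: algebra_simps)
    finally show ?thesis .
  qed
  have "P (\<lambda>w. 1 * of_real (p (g w)))"
  proof (rule real_polynomial_function_induct_mult[OF p, where P = P and u = "\<lambda>_. 1" and g = g])
    show "P (\<lambda>_. 1)" using lim by (auto simp: P_def)
  next
    fix h assume h: "P h"
    show "P (\<lambda>w. h w * of_real (Re (g w)))"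
      using sin[OF h, of "of_real (1 / R)"] by (simp add: g_def)
    show "P (\<lambda>w. h w * of_real (Im (g w)))"
      using sin[OF h, of "of_real (1 / R) * \<i>"] by (simp add: g_def)
  qed (fact add scale)+
  then have "\<forall>t. (\<lambda>n. LINT w|M n. of_real (q w) * character t w) \<longlonglongrightarrow> (LINT w|\<gamma>. of_real (q w) * character t w)"
    unfolding P_def by (simp add: q_def)
  from this[rule_format, of 0]
  have qlim: "(\<lambda>n. LINT w|M n. q w) \<longlonglongrightarrow> (LINT w|\<gamma>. q w)"
    by (simp add: tendsto_of_real_iff)
  have diff: "\<bar>(LINT w|\<nu>. \<phi> w) - (LINT w|\<nu>. q w)\<bar> \<le> e / 4"
    if \<nu>: "prob_space \<nu>" "sets \<nu> = sets borel" "integrable \<nu> (\<lambda>w. (norm w)\<^sup>2)" "(LINT w|\<nu>. (norm w)\<^sup>2) \<le> V" for \<nu>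
  proof -
    interpret \<nu>: prob_space \<nu> by fact
    have [measurable_cong]: "sets \<nu> = sets borel" by fact
    have i: "integrable \<nu> \<phi>" "integrable \<nu> q"
      using \<phi>(2) q2 by (auto intro: \<nu>.integrable_const_bound[where B = 1] \<nu>.integrable_const_bound[where B = 2])
    have "\<bar>LINT w|\<nu>. \<phi> w - q w\<bar> \<le> d + 3 * V / R\<^sup>2"
      by (rule tail_bound[OF \<nu> R]) (use close close3 d in auto)
    then show ?thesis using i VR d by simp
  qed
  have "\<forall>\<^sub>F n in sequentially. dist (LINT w|M n. q w) (LINT w|\<gamma>. q w) < e / 2"
    using qlim e by (intro tendstoD) auto
  then show "\<forall>\<^sub>F n in sequentially. dist (LINT w|M n. \<phi> w) (LINT w|\<gamma>. \<phi> w) < e"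
  proof eventually_elim
    case (elim n)
    then show ?case
      using diff[OF M Mint MV, of n] diff[OF \<gamma> \<gamma>int \<gamma>V] unfolding dist_real_def by linarith
  qed
qed

section \<open>The standard complex normal law\<close>

text \<open>
  As a product of two real standard normal laws, so that its characteristic function comes from the
  one-dimensional one.
\<close>

definition complex_normal :: "complex measure" where
  "complex_normal = distr (std_normal_distribution \<Otimes>\<^sub>M std_normal_distribution) borel (\<lambda>(x, y). Complex x y)"

lemma measurable_Complex_pair: "(\<lambda>(x, y). Complex x y) \<in> borel_measurable (borel \<Otimes>\<^sub>M borel)"
  unfolding Complex_eq case_prod_beta' by measurable

lemma lborel_complex: "(lborel :: complex measure) = distr (lborel \<Otimes>\<^sub>M lborel) borel (\<lambda>(x, y). Complex x y)"
proof (rule lborel_eqI)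
  fix l u :: complex assume le: "\<And>b. b \<in> Basis \<Longrightarrow> l \<bullet> b \<le> u \<bullet> b"
  have le': "Re l \<le> Re u" "Im l \<le> Im u"
    using le[of 1] le[of \<i>] by (auto simp: Basis_complex_def inner_complex_def)
  have "(\<lambda>(x, y). Complex x y) -` box l u \<inter> space (lborel \<Otimes>\<^sub>M lborel) = {Re l<..<Re u} \<times> {Im l<..<Im u}"
    by (auto simp: in_box_complex_iff space_pair_measure)
  then have "emeasure (distr (lborel \<Otimes>\<^sub>M lborel) borel (\<lambda>(x, y). Complex x y)) (box l u) =
     emeasure (lborel \<Otimes>\<^sub>M lborel) ({Re l<..<Re u} \<times> {Im l<..<Im u})"
    using measurable_Complex_pair by (subst emeasure_distr) auto
  also have "\<dots> = ennreal (Re u - Re l) * ennreal (Im u - Im l)"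
    using le' by (subst lborel.emeasure_pair_measure_Times) auto
  also have "\<dots> = ennreal (\<Prod>b\<in>Basis. (u - l) \<bullet> b)"
    using le' by (simp add: ennreal_mult Basis_complex_def inner_complex_def)
  finally show "emeasure (distr (lborel \<Otimes>\<^sub>M lborel) borel (\<lambda>(x, y). Complex x y)) (box l u) =
     ennreal (\<Prod>b\<in>Basis. (u - l) \<bullet> b)" .
qed simp

interpretation std_normal: prob_space std_normal_distribution
  using real_dist_normal_dist by (simp add: real_distribution_def)

interpretation std_normal_pair: pair_prob_space std_normal_distribution std_normal_distribution ..

lemma sets_complex_normal [simp, measurable_cong]: "sets complex_normal = sets borel"
  by (simp add: complex_normal_def)

lemma measurable_Complex_normal:
  "(\<lambda>(x, y). Complex x y) \<in> std_normal_distribution \<Otimes>\<^sub>M std_normal_distribution \<rightarrow>\<^sub>M borel"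
proof -
  have "sets (std_normal_distribution \<Otimes>\<^sub>M std_normal_distribution) = sets (borel \<Otimes>\<^sub>M borel)"
    by (intro sets_pair_measure_cong) auto
  then show ?thesis
    using measurable_Complex_pair by (simp cong: measurable_cong_sets)
qed

lemma prob_space_complex_normal: "prob_space complex_normal"
  unfolding complex_normal_def
  by (rule std_normal_pair.prob_space_distr) (rule measurable_Complex_normal)

lemma complex_normal_density:
  "complex_normal = density lborel (\<lambda>w. ennreal (exp (- (norm w)\<^sup>2 / 2) / (2 * pi)))"
proof -
  have "complex_normal = distr (density (lborel \<Otimes>\<^sub>M lborel)
          (\<lambda>(x, y). ennreal (std_normal_density x) * ennreal (std_normal_density y))) borel (\<lambda>(x, y). Complex x y)"
    unfolding complex_normal_def
    by (subst pair_measure_density) (auto intro!: sigma_finite_lborel std_normal.sigma_finite_measure_axioms)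
  also have "(\<lambda>(x, y). ennreal (std_normal_density x) * ennreal (std_normal_density y)) =
     (\<lambda>w. ennreal (exp (- (norm w)\<^sup>2 / 2) / (2 * pi))) \<circ> (\<lambda>(x, y). Complex x y)"
  proof -
    have "std_normal_density x * std_normal_density y = exp (- (norm (Complex x y))\<^sup>2 / 2) / (2 * pi)" for x y
    proof -
      have "std_normal_density x * std_normal_density y = exp (- x\<^sup>2 / 2) * exp (- y\<^sup>2 / 2) / (sqrt (2 * pi))\<^sup>2"
        by (simp add: std_normal_density_def power2_eq_square)
      also have "exp (- x\<^sup>2 / 2) * exp (- y\<^sup>2 / 2) = exp (- (norm (Complex x y))\<^sup>2 / 2)"
        by (simp add: cmod_def add_divide_distrib flip: exp_add)
      finally show ?thesis by simp
    qed
    then show ?thesis by (auto simp: fun_eq_iff simp flip: ennreal_mult)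
  qed
  also have "distr (density (lborel \<Otimes>\<^sub>M lborel) ((\<lambda>w. ennreal (exp (- (norm w)\<^sup>2 / 2) / (2 * pi))) \<circ> (\<lambda>(x, y). Complex x y)))
      borel (\<lambda>(x, y). Complex x y) =
      density (distr (lborel \<Otimes>\<^sub>M lborel) borel (\<lambda>(x, y). Complex x y)) (\<lambda>w. ennreal (exp (- (norm w)\<^sup>2 / 2) / (2 * pi)))"
    using measurable_Complex_pair by (subst density_distr) (auto simp: o_def)
  finally show ?thesis by (simp flip: lborel_complex)
qed

lemma measure_complex_normal:
  assumes K: "K \<in> sets borel"
  shows "measure complex_normal K = 1 / (2 * pi) * (LINT w:K|lborel. exp (- (norm w)\<^sup>2 / 2))"
proof -
  have [measurable]: "K \<in> sets lborel" using K by simp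
  have "measure complex_normal K = (LINT w|complex_normal. indicator K w)"
    using K by (simp add: complex_normal_def)
  also have "\<dots> = (LINT w|lborel. exp (- (norm w)\<^sup>2 / 2) / (2 * pi) * indicator K w)"
    unfolding complex_normal_density by (subst integral_density) auto
  also have "\<dots> = (LINT w|lborel. 1 / (2 * pi) * (indicator K w * exp (- (norm w)\<^sup>2 / 2)))"
    by (intro Bochner_Integration.integral_cong) auto
  finally show ?thesis by (simp add: set_lebesgue_integral_def)
qed

lemma complex_normal_null:
  assumes "N \<in> null_sets lborel"
  shows "measure complex_normal N = 0"
proof -
  have "N \<in> null_sets complex_normal"
    unfolding complex_normal_density
    using assms absolutely_continuousI_density[of "\<lambda>w. ennreal (exp (- (norm w)\<^sup>2 / 2) / (2 * pi))" lborel]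
    by (auto simp: absolutely_continuous_def)
  then show ?thesis by (simp add: measure_eq_0_null_sets)
qed

lemma complex_normal_character:
  "(LINT w|complex_normal. character t w) = of_real (exp (- (norm t)\<^sup>2 / 2))"
proof -
  let ?N = "std_normal_distribution"
  have "(LINT w|complex_normal. character t w) = (LINT p|(?N \<Otimes>\<^sub>M ?N). iexp (Re t * fst p) * iexp (Im t * snd p))"
    unfolding complex_normal_def
    by (subst integral_distr[OF measurable_Complex_normal])
       (auto simp: character_def cis_conv_exp case_prod_beta' algebra_simps simp flip: exp_add)
  also have "\<dots> = (LINT x|?N. (LINT y|?N. iexp (Re t * x) * iexp (Im t * y)))"
  proof (subst std_normal_pair.integral_fst'[symmetric])
    show "integrable (?N \<Otimes>\<^sub>M ?N) (\<lambda>p. iexp (Re t * fst p) * iexp (Im t * snd p))"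
      by (rule std_normal_pair.integrable_const_bound[where B = 1]) (auto simp: norm_mult)
  qed simp
  also have "\<dots> = char ?N (Re t) * char ?N (Im t)"
    by (simp add: char_def)
  also have "\<dots> = of_real (exp (- (norm t)\<^sup>2 / 2))"
    unfolding char_std_normal_distribution
    by (simp add: cmod_def add_divide_distrib flip: exp_add of_real_mult)
  finally show ?thesis .
qed

lemma complex_normal_second_moment:
  "integrable complex_normal (\<lambda>w. (norm w)\<^sup>2)" "(LINT w|complex_normal. (norm w)\<^sup>2) = 2"
proof -
  let ?N = "std_normal_distribution"
  have N: "integrable ?N (\<lambda>x. x\<^sup>2)" "(LINT x|?N. x\<^sup>2) = 1"
    using std_normal_distribution_even_moments[of 1] by (auto simp: numeral_2_eq_2)
  have fst: "fst \<in> ?N \<Otimes>\<^sub>M ?N \<rightarrow>\<^sub>M ?N" by measurable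
  have i1: "integrable (?N \<Otimes>\<^sub>M ?N) (\<lambda>p. (fst p)\<^sup>2)"
    using integrable_distr_eq[OF fst, of "\<lambda>x. x\<^sup>2"] N unfolding std_normal.distr_pair_fst by simp
  have v1: "(LINT p|(?N \<Otimes>\<^sub>M ?N). (fst p)\<^sup>2) = 1"
    using integral_distr[OF fst, of "\<lambda>x. x\<^sup>2"] N unfolding std_normal.distr_pair_fst by simp
  have i: "integrable (?N \<Otimes>\<^sub>M ?N) (\<lambda>p. (fst p)\<^sup>2)" "integrable (?N \<Otimes>\<^sub>M ?N) (\<lambda>p. (snd p)\<^sup>2)"
    using i1 std_normal_pair.integrable_product_swap[OF i1] by (auto simp: case_prod_beta')
  have v: "(LINT p|(?N \<Otimes>\<^sub>M ?N). (fst p)\<^sup>2) = 1" "(LINT p|(?N \<Otimes>\<^sub>M ?N). (snd p)\<^sup>2) = 1"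
    using v1 std_normal_pair.integral_product_swap[OF borel_measurable_integrable[OF i1]]
    by (auto simp: case_prod_beta')
  have eq: "(norm (case p of (x, y) \<Rightarrow> Complex x y))\<^sup>2 = (fst p)\<^sup>2 + (snd p)\<^sup>2" for p
    by (simp add: case_prod_beta' cmod_def)
  show "integrable complex_normal (\<lambda>w. (norm w)\<^sup>2)"
    unfolding complex_normal_def
    by (subst integrable_distr_eq[OF measurable_Complex_normal]) (auto simp: eq i)
  show "(LINT w|complex_normal. (norm w)\<^sup>2) = 2"
    unfolding complex_normal_def
    by (subst integral_distr[OF measurable_Complex_normal]) (auto simp: eq i v)
qed

section \<open>Reverse martingale differences\<close>

text \<open>
  All functions in the martingale argument are bounded and measurable; closing this class under the
  operations used keeps integrability out of the way.
\<close>

definition bounded_circle :: "(complex \<Rightarrow> complex) \<Rightarrow> bool" where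
  "bounded_circle G \<longleftrightarrow>
     G \<in> borel_measurable circle_measure \<and> (\<exists>B. \<forall>z. norm z = 1 \<longrightarrow> norm (G z) \<le> B)"

lemma bounded_circle_integrable: "bounded_circle G \<Longrightarrow> integrable circle_measure G"
  unfolding bounded_circle_def by (elim conjE exE, rule integrable_circle_bounded) auto

lemma bounded_circle_const: "bounded_circle (\<lambda>_. a)"
  by (auto simp: bounded_circle_def)

lemma bounded_circle_id: "bounded_circle (\<lambda>z. z)"
  by (auto simp: bounded_circle_def circle_id)

lemma bounded_circle_add:
  assumes "bounded_circle F" "bounded_circle G"
  shows "bounded_circle (\<lambda>z. F z + G z)"
proof -
  from assms obtain A B where "\<forall>z. norm z = 1 \<longrightarrow> norm (F z) \<le> A" "\<forall>z. norm z = 1 \<longrightarrow> norm (G z) \<le> B"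
    by (auto simp: bounded_circle_def)
  then have "\<forall>z. norm z = 1 \<longrightarrow> norm (F z + G z) \<le> A + B"
    by (meson add_mono norm_triangle_ineq order_trans)
  then show ?thesis using assms by (auto simp: bounded_circle_def)
qed

lemma bounded_circle_mult:
  assumes "bounded_circle F" "bounded_circle G"
  shows "bounded_circle (\<lambda>z. F z * G z)"
proof -
  from assms obtain A B where b: "\<forall>z. norm z = 1 \<longrightarrow> norm (F z) \<le> A" "\<forall>z. norm z = 1 \<longrightarrow> norm (G z) \<le> B"
    by (auto simp: bounded_circle_def)
  have "norm (F z * G z) \<le> A * B" if "norm z = 1" for z
    using b that order_trans[OF norm_ge_zero, of "F z" A] by (auto simp: norm_mult intro!: mult_mono)
  then show ?thesis using assms by (auto simp: bounded_circle_def)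
qed

lemma bounded_circle_diff:
  "bounded_circle F \<Longrightarrow> bounded_circle G \<Longrightarrow> bounded_circle (\<lambda>z. F z - G z)"
  using bounded_circle_add[of F "\<lambda>z. (-1) * G z"] bounded_circle_mult[OF bounded_circle_const[of "-1"], of G]
  by simp

lemma bounded_circle_power: "bounded_circle G \<Longrightarrow> bounded_circle (\<lambda>z. G z ^ k)"
  by (induction k) (auto intro: bounded_circle_const bounded_circle_mult)

lemma bounded_circle_cnj: "bounded_circle G \<Longrightarrow> bounded_circle (\<lambda>z. cnj (G z))"
  by (auto simp: bounded_circle_def intro: measurable_compose[OF _ measurable_cnj])

lemma bounded_circle_of_real_Re: "bounded_circle G \<Longrightarrow> bounded_circle (\<lambda>z. of_real (Re (G z)))"
  using abs_Re_le_cmod unfolding bounded_circle_def by (auto intro: order_trans)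

lemma bounded_circle_cis_Re: "bounded_circle G \<Longrightarrow> bounded_circle (\<lambda>z. cis (Re (G z)))"
proof -
  have "cis \<in> borel_measurable borel" by (intro borel_measurable_continuous_onI continuous_intros)
  then show "bounded_circle G \<Longrightarrow> bounded_circle (\<lambda>z. cis (Re (G z)))"
    unfolding bounded_circle_def
    by (auto intro!: measurable_compose[of "\<lambda>z. Re (G z)" _ borel cis])
qed

lemmas bounded_circle_intros =
  bounded_circle_const bounded_circle_id bounded_circle_add bounded_circle_mult bounded_circle_diff
  bounded_circle_power bounded_circle_cnj bounded_circle_of_real_Re bounded_circle_cis_Re

lemma norm_integral_circle_le:
  assumes "bounded_circle G" "\<And>z. norm z = 1 \<Longrightarrow> norm (G z) \<le> B"
  shows "norm (LINT z|circle_measure. G z) \<le> B"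
  by (rule order_trans[OF integral_norm_bound], rule circle.integral_le_const)
     (use assms bounded_circle_integrable in \<open>auto intro!: AE_I2\<close>)

lemma norm_cis_minus_1: "norm (cis x - 1) \<le> \<bar>x\<bar>"
  using iexp_approx1[of x 0] by (simp add: cis_conv_exp)

lemma norm_cis_quadratic:
  "norm (cis x - (1 + \<i> * of_real x - (of_real x)\<^sup>2 / 2)) \<le> \<bar>x\<bar> ^ 3 / 6"
  using iexp_approx1[of x 2]
  by (simp add: cis_conv_exp numeral_eq_Suc power_mult_distrib algebra_simps)

lemma exp_minus_linear:
  assumes "(y::real) \<ge> 0"
  shows "\<bar>exp (- y) - (1 - y)\<bar> \<le> y\<^sup>2"
proof -
  have "exp (- y) \<le> 1 / (1 + y)"
    using exp_ge_add_one_self[of y] assms by (simp add: exp_minus field_simps)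
  also have "\<dots> \<le> 1 - y + y\<^sup>2"
  proof -
    have "(1 - y + y\<^sup>2) * (1 + y) = 1 + y ^ 3" by (simp add: algebra_simps power2_eq_square power3_eq_cube)
    then show ?thesis using assms by (simp add: divide_le_eq)
  qed
  finally show ?thesis using exp_ge_add_one_self[of "-y"] by (simp add: abs_le_iff)
qed

text \<open>
  The only information about an inner function that the limit theorem uses: its boundary map
  preserves the measure, and the first two powers of the coordinate have conditional
  expectations \<open>c T\<close> and \<open>q T + c\<^sup>2 T\<^sup>2\<close> given \<open>T\<close>.
\<close>

locale circle_factor =
  fixes T :: "complex \<Rightarrow> complex" and c q :: complex
  assumes T: "T \<in> circle_measure \<rightarrow>\<^sub>M circle_measure"
    and preserved: "distr circle_measure circle_measure T = circle_measure"
    and norm_c: "norm c < 1"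
    and first_moment: "\<And>G. integrable circle_measure G \<Longrightarrow>
          (LINT z|circle_measure. z * G (T z)) = c * (LINT z|circle_measure. z * G z)"
    and second_moment: "\<And>G. integrable circle_measure G \<Longrightarrow>
          (LINT z|circle_measure. z\<^sup>2 * G (T z)) =
            q * (LINT z|circle_measure. z * G z) + c\<^sup>2 * (LINT z|circle_measure. z\<^sup>2 * G z)"
begin

abbreviation E :: "(complex \<Rightarrow> complex) \<Rightarrow> complex" where
  "E G \<equiv> (LINT z|circle_measure. G z)"

definition incr :: "complex \<Rightarrow> complex" where "incr z = z - c * T z"

text \<open>
  A weighted sum of reverse martingale differences, \<open>\<Sum>i. bs ! i * incr \<circ> T ^^ i\<close>, plus the boundary
  term \<open>g * T ^^ length bs\<close>.  The recursion peels off the first difference; all others are functions of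
  \<open>T z\<close>, which is what conditioning on \<open>T\<close> requires.
\<close>

primrec incr_sum :: "complex \<Rightarrow> complex list \<Rightarrow> complex \<Rightarrow> complex" where
  "incr_sum g [] z = g * z"
| "incr_sum g (b # bs) z = b * incr z + incr_sum g bs (T z)"

definition phase :: "complex \<Rightarrow> complex list \<Rightarrow> complex \<Rightarrow> complex" where
  "phase g bs z = cis (Re (incr_sum g bs z))"

lemma norm_T: "norm z = 1 \<Longrightarrow> norm (T z) = 1"
  using measurable_space[OF T, of z] by simp

lemma bounded_circle_T: "bounded_circle G \<Longrightarrow> bounded_circle (\<lambda>z. G (T z))"
  unfolding bounded_circle_def using norm_T by (auto intro: measurable_compose[OF T])

lemma E_T: "bounded_circle G \<Longrightarrow> E (\<lambda>z. G (T z)) = E G"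
  using integral_distr[OF T, of G] preserved by (auto simp: bounded_circle_def)

lemma bounded_circle_T_id: "bounded_circle T"
  using bounded_circle_T[OF bounded_circle_id] by simp

lemma bounded_circle_incr: "bounded_circle incr"
  unfolding incr_def by (intro bounded_circle_intros bounded_circle_T_id)

lemma norm_incr:
  assumes "norm z = 1" shows "norm (incr z) \<le> 2"
proof -
  have "norm (incr z) \<le> norm z + norm (c * T z)" unfolding incr_def by (rule norm_triangle_ineq4)
  then show ?thesis using assms norm_T[OF assms] norm_c by (simp add: norm_mult)
qed

lemma bounded_circle_incr_sum: "bounded_circle (incr_sum g bs)"
proof (induction bs)
  case Nil
  have "bounded_circle (\<lambda>z. g * z)" by (intro bounded_circle_intros)
  then show ?case by simp
next
  case (Cons b bs)
  have "bounded_circle (\<lambda>z. b * incr z + incr_sum g bs (T z))"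
    by (intro bounded_circle_intros bounded_circle_incr bounded_circle_T Cons)
  then show ?case by simp
qed

lemma bounded_circle_phase: "bounded_circle (phase g bs)"
  unfolding phase_def by (intro bounded_circle_intros bounded_circle_incr_sum)

lemma norm_phase [simp]: "norm (phase g bs z) = 1"
  by (simp add: phase_def)

lemma phase_Cons: "phase g (b # bs) z = cis (Re (b * incr z)) * phase g bs (T z)"
  by (simp add: phase_def cis_mult)

lemma E_cnj: "E (\<lambda>z. cnj (G z)) = cnj (E G)"
  by simp

lemma E_z: "E (\<lambda>z. z) = 0"
proof -
  have "E (\<lambda>z. z) = c * E (\<lambda>z. z)" using first_moment[of "\<lambda>_. 1"] by simp
  moreover have "c \<noteq> 1" using norm_c by auto
  ultimately show ?thesis by (metis mult_cancel_right1)
qed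

lemma first_moment':
  assumes "bounded_circle G"
  shows "E (\<lambda>z. z * G (T z)) = c * E (\<lambda>z. z * G z)"
    and "E (\<lambda>z. cnj z * G (T z)) = cnj c * E (\<lambda>z. cnj z * G z)"
proof -
  show "E (\<lambda>z. z * G (T z)) = c * E (\<lambda>z. z * G z)"
    by (rule first_moment[OF bounded_circle_integrable[OF assms]])
  have "E (\<lambda>z. cnj (z * cnj (G (T z)))) = cnj c * E (\<lambda>z. cnj (z * cnj (G z)))"
    unfolding E_cnj first_moment[OF bounded_circle_integrable[OF bounded_circle_cnj[OF assms]]] by simp
  then show "E (\<lambda>z. cnj z * G (T z)) = cnj c * E (\<lambda>z. cnj z * G z)"
    by simp
qed

text \<open>
  Martingale property: \<open>incr\<close> has conditional mean \<open>c T - c T = 0\<close> given \<open>T\<close>.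
\<close>

lemma incr_orthogonal:
  assumes G: "bounded_circle G"
  shows "E (\<lambda>z. incr z * G (T z)) = 0" "E (\<lambda>z. cnj (incr z) * G (T z)) = 0"
proof -
  have *: "E (\<lambda>z. incr z * G (T z)) = 0" if G: "bounded_circle G" for G
  proof -
    note i = bounded_circle_intros G bounded_circle_T[OF G] bounded_circle_T_id
    have "E (\<lambda>z. incr z * G (T z)) = E (\<lambda>z. z * G (T z) - c * (T z * G (T z)))"
      by (simp add: incr_def algebra_simps)
    also have "\<dots> = E (\<lambda>z. z * G (T z)) - c * E (\<lambda>z. T z * G (T z))"
      by (subst Bochner_Integration.integral_diff)
         (auto intro!: bounded_circle_integrable i simp del: integrable_mult_right_iff)
    also have "E (\<lambda>z. T z * G (T z)) = E (\<lambda>z. z * G z)"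
      by (rule E_T[of "\<lambda>z. z * G z"]) (intro i)
    finally show ?thesis using first_moment'(1)[OF G] by simp
  qed
  show "E (\<lambda>z. incr z * G (T z)) = 0" by (rule *[OF G])
  have "E (\<lambda>z. cnj (incr z * cnj (G (T z)))) = 0"
    unfolding E_cnj *[OF bounded_circle_cnj[OF G]] by simp
  then show "E (\<lambda>z. cnj (incr z) * G (T z)) = 0" by simp
qed

text \<open>
  The conditional variance is constant because \<open>T\<close> is unimodular:
  \<open>1 + (norm c)\<^sup>2\<close> minus twice the real part of the conditional expectation of \<open>cnj c * z * cnj T\<close>,
  which is \<open>(norm c)\<^sup>2\<close>.
\<close>

lemma incr_norm_square:
  assumes G: "bounded_circle G"
  shows "E (\<lambda>z. incr z * cnj (incr z) * G (T z)) = (1 - (norm c)\<^sup>2) * E G"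
proof -
  note i = bounded_circle_intros G bounded_circle_T[OF G] bounded_circle_T_id bounded_circle_integrable
  have cc: "c * cnj c = of_real ((norm c)\<^sup>2)" by (rule complex_norm_square[symmetric])
  have z1: "z * cnj z = 1" if "norm z = 1" for z
    using complex_norm_square[of z] that by simp
  have "E (\<lambda>z. incr z * cnj (incr z) * G (T z)) =
      E (\<lambda>z. (1 + of_real ((norm c)\<^sup>2)) * G (T z) - cnj c * (z * (cnj (T z) * G (T z))) - c * (cnj z * (T z * G (T z))))"
  proof (intro Bochner_Integration.integral_cong refl)
    fix z assume "z \<in> space circle_measure"
    then have z: "norm z = 1" by simp
    have "incr z * cnj (incr z) = z * cnj z + (c * cnj c) * (T z * cnj (T z)) - cnj c * (z * cnj (T z)) - c * (cnj z * T z)"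
      by (simp add: incr_def algebra_simps)
    then have "incr z * cnj (incr z) = 1 + of_real ((norm c)\<^sup>2) - cnj c * (z * cnj (T z)) - c * (cnj z * T z)"
      by (simp add: z1[OF z] z1[OF norm_T[OF z]] cc)
    then show "incr z * cnj (incr z) * G (T z) = (1 + of_real ((norm c)\<^sup>2)) * G (T z) - cnj c * (z * (cnj (T z) * G (T z))) - c * (cnj z * (T z * G (T z)))"
      by (simp only: left_diff_distrib mult.assoc)
  qed
  also have "\<dots> = (1 + of_real ((norm c)\<^sup>2)) * E (\<lambda>z. G (T z)) - cnj c * E (\<lambda>z. z * (cnj (T z) * G (T z))) - c * E (\<lambda>z. cnj z * (T z * G (T z)))"
    by (subst Bochner_Integration.integral_diff, (intro i)+)+ simp
  also have "E (\<lambda>z. z * (cnj (T z) * G (T z))) = c * E G"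
  proof -
    have "E (\<lambda>z. z * (cnj (T z) * G (T z))) = c * E (\<lambda>z. z * (cnj z * G z))"
      by (rule first_moment'(1)[of "\<lambda>z. cnj z * G z"]) (intro i)
    also have "E (\<lambda>z. z * (cnj z * G z)) = E G"
      by (intro Bochner_Integration.integral_cong) (auto simp: z1 simp flip: mult.assoc)
    finally show ?thesis .
  qed
  also have "E (\<lambda>z. cnj z * (T z * G (T z))) = cnj c * E G"
  proof -
    have "E (\<lambda>z. cnj z * (T z * G (T z))) = cnj c * E (\<lambda>z. cnj z * (z * G z))"
      by (rule first_moment'(2)[of "\<lambda>z. z * G z"]) (intro i)
    also have "E (\<lambda>z. cnj z * (z * G z)) = E G"
      by (intro Bochner_Integration.integral_cong) (auto simp: z1 mult.commute[of "cnj _"] simp flip: mult.assoc)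
    finally show ?thesis .
  qed
  also have "E (\<lambda>z. G (T z)) = E G" by (rule E_T[OF G])
  finally have "E (\<lambda>z. incr z * cnj (incr z) * G (T z)) =
      (1 + of_real ((norm c)\<^sup>2)) * E G - cnj c * (c * E G) - c * (cnj c * E G)" .
  moreover have "cnj c * (c * e) = of_real ((norm c)\<^sup>2) * e" "c * (cnj c * e) = of_real ((norm c)\<^sup>2) * e" for e
    by (simp_all only: cc[symmetric] mult_ac)
  ultimately show ?thesis by (simp add: algebra_simps)
qed

text \<open>
  In \<open>(z - c T)\<^sup>2\<close> the contributions of \<open>c\<^sup>2 T\<^sup>2\<close> cancel, and only the linear term \<open>q T\<close> of the
  conditional expectation of \<open>z\<^sup>2\<close> survives.
\<close>

lemma incr_square:
  assumes G: "bounded_circle G"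
  shows "E (\<lambda>z. (incr z)\<^sup>2 * G (T z)) = q * E (\<lambda>z. z * G z)"
    and "E (\<lambda>z. (cnj (incr z))\<^sup>2 * G (T z)) = cnj q * E (\<lambda>z. cnj z * G z)"
proof -
  have *: "E (\<lambda>z. (incr z)\<^sup>2 * G (T z)) = q * E (\<lambda>z. z * G z)" if G: "bounded_circle G" for G
  proof -
    note i = bounded_circle_intros G bounded_circle_T[OF G] bounded_circle_T_id bounded_circle_integrable
    have "E (\<lambda>z. (incr z)\<^sup>2 * G (T z)) =
       E (\<lambda>z. z\<^sup>2 * G (T z) - 2 * c * (z * (T z * G (T z))) + c\<^sup>2 * ((T z)\<^sup>2 * G (T z)))"
      by (simp add: incr_def power2_eq_square algebra_simps)
    also have "\<dots> = E (\<lambda>z. z\<^sup>2 * G (T z)) - 2 * c * E (\<lambda>z. z * (T z * G (T z))) + c\<^sup>2 * E (\<lambda>z. (T z)\<^sup>2 * G (T z))"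
      by (subst Bochner_Integration.integral_add, (intro i)+, subst Bochner_Integration.integral_diff, (intro i)+) simp
    also have "E (\<lambda>z. (T z)\<^sup>2 * G (T z)) = E (\<lambda>z. z\<^sup>2 * G z)"
      by (rule E_T[of "\<lambda>z. z\<^sup>2 * G z"]) (intro i)
    also have "E (\<lambda>z. z * (T z * G (T z))) = c * E (\<lambda>z. z\<^sup>2 * G z)"
      using first_moment'(1)[of "\<lambda>z. z * G z"] i by (simp add: power2_eq_square mult.assoc)
    also have "E (\<lambda>z. z\<^sup>2 * G (T z)) = q * E (\<lambda>z. z * G z) + c\<^sup>2 * E (\<lambda>z. z\<^sup>2 * G z)"
      by (rule second_moment) (intro i)
    finally show ?thesis by (simp add: power2_eq_square)
  qed
  show "E (\<lambda>z. (incr z)\<^sup>2 * G (T z)) = q * E (\<lambda>z. z * G z)" by (rule *[OF G])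
  have "E (\<lambda>z. cnj ((incr z)\<^sup>2 * cnj (G (T z)))) = cnj q * E (\<lambda>z. cnj (z * cnj (G z)))"
    unfolding E_cnj *[OF bounded_circle_cnj[OF G]] by simp
  then show "E (\<lambda>z. (cnj (incr z))\<^sup>2 * G (T z)) = cnj q * E (\<lambda>z. cnj z * G z)" by simp
qed

text \<open>
  Orthogonality of the differences.
\<close>

lemma E_norm_incr_sum_square:
  "E (\<lambda>z. incr_sum g bs z * cnj (incr_sum g bs z)) =
     of_real ((1 - (norm c)\<^sup>2) * (\<Sum>b\<leftarrow>bs. (norm b)\<^sup>2) + (norm g)\<^sup>2)"
proof (induction bs)
  case Nil
  have "E (\<lambda>z. incr_sum g [] z * cnj (incr_sum g [] z)) = E (\<lambda>z. of_real ((norm g)\<^sup>2))"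
    by (intro Bochner_Integration.integral_cong refl, unfold incr_sum.simps complex_norm_square[symmetric])
       (simp add: norm_mult)
  then show ?case by (simp add: circle.prob_space[simplified])
next
  case (Cons b bs)
  define V where "V = incr_sum g bs"
  have V: "bounded_circle V" unfolding V_def by (rule bounded_circle_incr_sum)
  note i = bounded_circle_intros V bounded_circle_T[OF V] bounded_circle_incr bounded_circle_integrable
  have incr2: "E (\<lambda>z. incr z * cnj (incr z)) = 1 - (norm c)\<^sup>2"
    using incr_norm_square[OF bounded_circle_const[of 1]] by (simp add: circle.prob_space[simplified])
  have bb: "b * cnj b = of_real ((norm b)\<^sup>2)" by (rule complex_norm_square[symmetric])
  have "E (\<lambda>z. incr_sum g (b # bs) z * cnj (incr_sum g (b # bs) z)) =
     E (\<lambda>z. b * cnj b * (incr z * cnj (incr z)) + b * (incr z * cnj (V (T z))) + cnj b * (cnj (incr z) * V (T z)) + V (T z) * cnj (V (T z)))"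
    by (simp add: V_def algebra_simps)
  also have "\<dots> = b * cnj b * E (\<lambda>z. incr z * cnj (incr z)) + b * E (\<lambda>z. incr z * cnj (V (T z))) + cnj b * E (\<lambda>z. cnj (incr z) * V (T z)) + E (\<lambda>z. V (T z) * cnj (V (T z)))"
    by (subst Bochner_Integration.integral_add, (intro i)+)+ simp
  also have "E (\<lambda>z. incr z * cnj (V (T z))) = 0"
    by (rule incr_orthogonal(1)[OF bounded_circle_cnj[OF V]])
  also have "E (\<lambda>z. cnj (incr z) * V (T z)) = 0"
    by (rule incr_orthogonal(2)[OF V])
  also have "E (\<lambda>z. V (T z) * cnj (V (T z))) = E (\<lambda>z. V z * cnj (V z))"
    by (rule E_T[of "\<lambda>z. V z * cnj (V z)"]) (intro i)
  finally show ?case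
    unfolding incr2 bb V_def Cons.IH by (simp add: algebra_simps)
qed

text \<open>
  The phase depends on its first difference only through a factor \<open>1 + O(\<delta>)\<close>.  After dropping that
  factor, conditioning on \<open>T\<close> replaces \<open>z\<close> by \<open>c * z\<close> and shortens the list.  The bound \<open>K * \<delta>\<close>
  therefore obeys \<open>K = 2 + norm c * K\<close>, whatever the length of the list.
\<close>

lemma E_z_phase:
  assumes "norm g \<le> \<delta>" "\<And>b. b \<in> set bs \<Longrightarrow> norm b \<le> \<delta>"
  shows "norm (E (\<lambda>z. z * phase g bs z)) \<le> 2 / (1 - norm c) * \<delta>"
    and "norm (E (\<lambda>z. cnj z * phase g bs z)) \<le> 2 / (1 - norm c) * \<delta>"
proof -
  define K where "K = 2 / (1 - norm c)"
  have K: "K \<ge> 2" "2 + norm c * K = K"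
    using norm_c by (auto simp: K_def field_simps)
  \<comment> \<open>The same induction serves the two cases \<open>j = (\<lambda>z. z)\<close> and \<open>j = cnj\<close>.\<close>
  have *: "norm (E (\<lambda>z. j z * phase g bs z)) \<le> K * \<delta>"
    if j: "bounded_circle j" "\<And>z. norm (j z) = norm z" "E j = 0"
      and jT: "\<And>G. bounded_circle G \<Longrightarrow> norm (E (\<lambda>z. j z * G (T z))) = norm c * norm (E (\<lambda>z. j z * G z))"
    for j :: "complex \<Rightarrow> complex"
    using assms(2)
  proof (induction bs)
    case Nil
    have \<delta>: "0 \<le> \<delta>" using assms(1) norm_ge_zero order_trans by blast
    note i = bounded_circle_intros j bounded_circle_phase
    have "E (\<lambda>z. j z * phase g [] z) = E (\<lambda>z. j z * (phase g [] z - 1) + j z)"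
      by (simp add: algebra_simps)
    also have "\<dots> = E (\<lambda>z. j z * (phase g [] z - 1)) + E j"
      by (rule Bochner_Integration.integral_add; intro bounded_circle_integrable i)
    also have "norm \<dots> \<le> norm g"
      unfolding j(3) add_0_right
    proof (rule norm_integral_circle_le)
      show "bounded_circle (\<lambda>z. j z * (phase g [] z - 1))" by (intro i)
      show "norm (j z * (phase g [] z - 1)) \<le> norm g" if "norm z = 1" for z
        using norm_cis_minus_1[of "Re (g * z)"] abs_Re_le_cmod[of "g * z"] that
        by (simp add: norm_mult j phase_def)
    qed
    also have "\<dots> \<le> K * \<delta>" using assms(1) \<delta> K mult_right_mono[of 1 K \<delta>] by simp
    finally show ?case .
  next
    case (Cons b bs)
    note i = bounded_circle_intros j bounded_circle_phase bounded_circle_T[OF bounded_circle_phase] bounded_circle_incr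
    have b: "norm b \<le> \<delta>" using Cons.prems by simp
    have "E (\<lambda>z. j z * phase g (b # bs) z) = E (\<lambda>z. j z * (cis (Re (b * incr z)) - 1) * phase g bs (T z) + j z * phase g bs (T z))"
      by (simp add: phase_Cons algebra_simps)
    also have "\<dots> = E (\<lambda>z. j z * (cis (Re (b * incr z)) - 1) * phase g bs (T z)) + E (\<lambda>z. j z * phase g bs (T z))"
      by (rule Bochner_Integration.integral_add; intro bounded_circle_integrable i)
    also have "norm \<dots> \<le> 2 * \<delta> + norm c * (K * \<delta>)"
    proof (rule order_trans[OF norm_triangle_ineq], rule add_mono)
      show "norm (E (\<lambda>z. j z * (cis (Re (b * incr z)) - 1) * phase g bs (T z))) \<le> 2 * \<delta>"
      proof (rule norm_integral_circle_le)
        show "bounded_circle (\<lambda>z. j z * (cis (Re (b * incr z)) - 1) * phase g bs (T z))" by (intro i)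
        show "norm (j z * (cis (Re (b * incr z)) - 1) * phase g bs (T z)) \<le> 2 * \<delta>" if z: "norm z = 1" for z
        proof -
          have "\<bar>Re (b * incr z)\<bar> \<le> norm b * norm (incr z)" using abs_Re_le_cmod[of "b * incr z"] by (simp add: norm_mult)
          also have "\<dots> \<le> \<delta> * 2" using b norm_incr[OF z] order_trans[OF norm_ge_zero b] by (intro mult_mono) auto
          finally show ?thesis using norm_cis_minus_1[of "Re (b * incr z)"] z by (simp add: norm_mult j)
        qed
      qed
      show "norm (E (\<lambda>z. j z * phase g bs (T z))) \<le> norm c * (K * \<delta>)"
        unfolding jT[OF bounded_circle_phase] using Cons by (intro mult_left_mono) auto
    qed
    also have "\<dots> = K * \<delta>" by (subst (2) K(2)[symmetric]) (simp add: algebra_simps)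
    finally show ?case .
  qed
  show "norm (E (\<lambda>z. z * phase g bs z)) \<le> 2 / (1 - norm c) * \<delta>"
    using *[of "\<lambda>z. z"] by (simp add: K_def bounded_circle_intros E_z first_moment' norm_mult)
  show "norm (E (\<lambda>z. cnj z * phase g bs z)) \<le> 2 / (1 - norm c) * \<delta>"
    using *[of cnj] bounded_circle_cnj[OF bounded_circle_id]
    by (simp add: K_def bounded_circle_intros E_z first_moment' norm_mult)
qed

text \<open>
  With \<open>x = Re (b * incr)\<close>, expand \<open>cis x = 1 + \<i> x - x\<^sup>2 / 2 + O(x\<^sup>3)\<close> and condition on \<open>T\<close>.  The linear
  term vanishes.  The quadratic term gives the constant variance \<open>v\<close>, plus the terms in \<open>b\<^sup>2\<close> and its
  conjugate, which are controlled by \<open>E_z_phase\<close>.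
\<close>

lemma E_phase_step:
  assumes "norm g \<le> \<delta>" "norm b \<le> \<delta>" "\<And>b. b \<in> set bs \<Longrightarrow> norm b \<le> \<delta>" "\<delta> \<le> 1"
  shows "norm (E (phase g (b # bs)) - of_real (exp (- (1 - (norm c)\<^sup>2) / 4 * (norm b)\<^sup>2)) * E (phase g bs))
           \<le> (2 + norm q * (2 / (1 - norm c))) * \<delta> * (norm b)\<^sup>2"
proof -
  define K where "K = 2 / (1 - norm c)"
  define v where "v = (1 - (norm c)\<^sup>2) / 2 * (norm b)\<^sup>2"
  define x where "x z = Re (b * incr z)" for z
  define G where "G = phase g bs"
  define \<rho> where "\<rho> z = cis (x z) - (1 + \<i> * of_real (x z) - (of_real (x z))\<^sup>2 / 2) - (of_real (exp (- v / 2)) - (1 - v / 2))" for z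
  have G: "bounded_circle G" unfolding G_def by (rule bounded_circle_phase)
  have nG: "norm (G z) = 1" for z by (simp add: G_def)
  have \<delta>: "0 \<le> \<delta>" using assms(1) norm_ge_zero order_trans by blast
  have K0: "K \<ge> 0" using norm_c by (simp add: K_def)
  have bx: "bounded_circle (\<lambda>z. of_real (x z))" "bounded_circle (\<lambda>z. cis (x z))"
    unfolding x_def by (intro bounded_circle_intros bounded_circle_incr)+
  note i = bounded_circle_intros G bounded_circle_T[OF G] bounded_circle_incr bx bounded_circle_integrable
  have b\<rho>: "bounded_circle \<rho>"
    unfolding \<rho>_def divide_inverse by (intro i)
  have x_cnj: "of_real (x z) = (b * incr z + cnj b * cnj (incr z)) / 2" for z
    using complex_add_cnj[of "b * incr z"] by (simp add: x_def)
  have bb: "b * cnj b = of_real ((norm b)\<^sup>2)" by (rule complex_norm_square[symmetric])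
  have v: "0 \<le> v" "v \<le> (norm b)\<^sup>2 / 2"
  proof -
    have "(norm c)\<^sup>2 \<le> 1" using norm_c by (simp add: power_le_one)
    then show "0 \<le> v" by (simp add: v_def)
    show "v \<le> (norm b)\<^sup>2 / 2" unfolding v_def by (simp add: field_simps)
  qed
  have Ex: "E (\<lambda>z. of_real (x z) * G (T z)) = 0"
  proof -
    have "E (\<lambda>z. of_real (x z) * G (T z)) = E (\<lambda>z. b / 2 * (incr z * G (T z)) + cnj b / 2 * (cnj (incr z) * G (T z)))"
      unfolding x_cnj by (simp add: algebra_simps add_divide_distrib)
    also have "\<dots> = b / 2 * E (\<lambda>z. incr z * G (T z)) + cnj b / 2 * E (\<lambda>z. cnj (incr z) * G (T z))"
      by (subst Bochner_Integration.integral_add, (intro i)+) simp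
    finally show ?thesis by (simp only: incr_orthogonal[OF G]) simp
  qed
  have Ex2: "E (\<lambda>z. (of_real (x z))\<^sup>2 * G (T z)) - v * E G =
       b\<^sup>2 / 4 * (q * E (\<lambda>z. z * G z)) + (cnj b)\<^sup>2 / 4 * (cnj q * E (\<lambda>z. cnj z * G z))"
  proof -
    have "E (\<lambda>z. (of_real (x z))\<^sup>2 * G (T z)) =
       E (\<lambda>z. b\<^sup>2 / 4 * ((incr z)\<^sup>2 * G (T z)) + (cnj b)\<^sup>2 / 4 * ((cnj (incr z))\<^sup>2 * G (T z)) + b * cnj b / 2 * (incr z * cnj (incr z) * G (T z)))"
      unfolding x_cnj by (intro Bochner_Integration.integral_cong) (auto simp: power2_eq_square field_simps)
    also have "\<dots> = b\<^sup>2 / 4 * E (\<lambda>z. (incr z)\<^sup>2 * G (T z)) + (cnj b)\<^sup>2 / 4 * E (\<lambda>z. (cnj (incr z))\<^sup>2 * G (T z)) + b * cnj b / 2 * E (\<lambda>z. incr z * cnj (incr z) * G (T z))"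
      by (subst Bochner_Integration.integral_add, (intro i)+)+ simp
    finally show ?thesis
      unfolding incr_square[OF G] incr_norm_square[OF G] bb by (simp add: v_def field_simps)
  qed
  have x_le: "\<bar>x z\<bar> \<le> 2 * norm b" if "norm z = 1" for z
    using abs_Re_le_cmod[of "b * incr z"] mult_left_mono[OF norm_incr[OF that], of "norm b"]
    by (simp add: x_def norm_mult)
  have \<rho>_le: "norm (\<rho> z) \<le> 2 * \<delta> * (norm b)\<^sup>2" if z: "norm z = 1" for z
  proof -
    have "norm (\<rho> z) \<le> norm (cis (x z) - (1 + \<i> * of_real (x z) - (of_real (x z))\<^sup>2 / 2)) + norm (of_real (exp (- v / 2) - (1 - v / 2)) :: complex)"
      unfolding \<rho>_def by (rule order_trans[OF norm_triangle_ineq4]) simp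
    also have "\<dots> \<le> \<bar>x z\<bar> ^ 3 / 6 + (v / 2)\<^sup>2"
      using norm_cis_quadratic[of "x z"] exp_minus_linear[of "v / 2"] v by (simp only: norm_of_real) auto
    also have "\<dots> \<le> 4 / 3 * (\<delta> * (norm b)\<^sup>2) + 1 / 16 * (\<delta> * (norm b)\<^sup>2)"
    proof (rule add_mono)
      have "\<bar>x z\<bar> ^ 3 \<le> (2 * norm b) ^ 3" using x_le[OF z] by (intro power_mono) auto
      also have "\<dots> = 8 * (norm b * (norm b)\<^sup>2)" by (simp add: power3_eq_cube power2_eq_square)
      also have "\<dots> \<le> 8 * (\<delta> * (norm b)\<^sup>2)" using assms(2) by (intro mult_left_mono mult_right_mono) auto
      finally show "\<bar>x z\<bar> ^ 3 / 6 \<le> 4 / 3 * (\<delta> * (norm b)\<^sup>2)" by simp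
      have "(v / 2)\<^sup>2 \<le> ((norm b)\<^sup>2 / 4)\<^sup>2" using v by (intro power_mono) auto
      also have "\<dots> = 1 / 16 * ((norm b)\<^sup>2 * (norm b)\<^sup>2)" by (simp add: power2_eq_square)
      also have "\<dots> \<le> 1 / 16 * (\<delta> * (norm b)\<^sup>2)"
      proof (intro mult_left_mono mult_right_mono)
        have "norm b * norm b \<le> 1 * \<delta>" using assms(2,4) \<delta> by (intro mult_mono) auto
        then show "(norm b)\<^sup>2 \<le> \<delta>" by (simp add: power2_eq_square)
      qed auto
      finally show "(v / 2)\<^sup>2 \<le> 1 / 16 * (\<delta> * (norm b)\<^sup>2)" .
    qed
    also have "\<dots> \<le> 2 * \<delta> * (norm b)\<^sup>2" using \<delta> by (simp add: field_simps)
    finally show ?thesis .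
  qed
  have "E (phase g (b # bs)) = E (\<lambda>z. of_real (exp (- v / 2)) * G (T z) + \<i> * (of_real (x z) * G (T z)) -
         1 / 2 * ((of_real (x z))\<^sup>2 * G (T z)) + v / 2 * G (T z) + \<rho> z * G (T z))"
    unfolding phase_Cons G_def x_def[symmetric] by (simp add: \<rho>_def algebra_simps)
  also have "\<dots> = of_real (exp (- v / 2)) * E (\<lambda>z. G (T z)) + \<i> * E (\<lambda>z. of_real (x z) * G (T z)) -
         1 / 2 * E (\<lambda>z. (of_real (x z))\<^sup>2 * G (T z)) + v / 2 * E (\<lambda>z. G (T z)) + E (\<lambda>z. \<rho> z * G (T z))"
    by (subst Bochner_Integration.integral_add Bochner_Integration.integral_diff, (intro i b\<rho>)+)+ simp
  finally have "E (phase g (b # bs)) - of_real (exp (- v / 2)) * E G =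
       - 1 / 2 * (E (\<lambda>z. (of_real (x z))\<^sup>2 * G (T z)) - v * E G) + E (\<lambda>z. \<rho> z * G (T z))"
    unfolding E_T[OF G] Ex by (simp add: algebra_simps)
  also have "norm \<dots> \<le> norm q * K * \<delta> * (norm b)\<^sup>2 + 2 * \<delta> * (norm b)\<^sup>2"
  proof (rule order_trans[OF norm_triangle_ineq], rule add_mono)
    show "norm (E (\<lambda>z. \<rho> z * G (T z))) \<le> 2 * \<delta> * (norm b)\<^sup>2"
      by (rule norm_integral_circle_le) (use \<rho>_le in \<open>auto intro!: i b\<rho> simp: norm_mult nG\<close>)
    have "norm (E (\<lambda>z. (of_real (x z))\<^sup>2 * G (T z)) - v * E G) \<le>
        (norm b)\<^sup>2 / 4 * (norm q * norm (E (\<lambda>z. z * G z))) + (norm b)\<^sup>2 / 4 * (norm q * norm (E (\<lambda>z. cnj z * G z)))"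
      unfolding Ex2 by (rule order_trans[OF norm_triangle_ineq]) (simp add: norm_mult norm_divide norm_power)
    also have "\<dots> \<le> (norm b)\<^sup>2 / 4 * (norm q * (K * \<delta>)) + (norm b)\<^sup>2 / 4 * (norm q * (K * \<delta>))"
      unfolding G_def K_def using E_z_phase[of g \<delta> bs] assms by (intro add_mono mult_left_mono) auto
    also have "\<dots> \<le> 2 * (norm q * K * \<delta> * (norm b)\<^sup>2)"
      using K0 \<delta> by (simp add: field_simps)
    finally show "norm (- 1 / 2 * (E (\<lambda>z. (of_real (x z))\<^sup>2 * G (T z)) - v * E G)) \<le> norm q * K * \<delta> * (norm b)\<^sup>2"
      by (simp add: norm_mult)
  qed
  also have "norm q * K * \<delta> * (norm b)\<^sup>2 + 2 * \<delta> * (norm b)\<^sup>2 = (2 + norm q * K) * \<delta> * (norm b)\<^sup>2"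
    by (simp add: algebra_simps)
  also have "- v / 2 = - (1 - (norm c)\<^sup>2) / 4 * (norm b)\<^sup>2"
    by (simp add: v_def field_simps)
  finally show ?thesis
    unfolding K_def G_def .
qed

text \<open>
  Since the error of each step is proportional to \<open>\<delta> * (norm b)\<^sup>2\<close>, the accumulated error is
  proportional to \<open>\<delta>\<close> times the total variance.
\<close>

lemma E_phase:
  assumes "norm g \<le> \<delta>" "\<And>b. b \<in> set bs \<Longrightarrow> norm b \<le> \<delta>" "\<delta> \<le> 1"
  shows "norm (E (phase g bs) - of_real (exp (- (1 - (norm c)\<^sup>2) / 4 * (\<Sum>b\<leftarrow>bs. (norm b)\<^sup>2))))
           \<le> \<delta> + (2 + norm q * (2 / (1 - norm c))) * \<delta> * (\<Sum>b\<leftarrow>bs. (norm b)\<^sup>2)"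
  using assms(2)
proof (induction bs)
  case Nil
  have "E (phase g []) - 1 = E (\<lambda>z. phase g [] z - 1)"
    by (subst Bochner_Integration.integral_diff)
       (auto intro!: bounded_circle_integrable bounded_circle_phase simp: circle.prob_space[simplified])
  also have "norm \<dots> \<le> norm g"
  proof (rule norm_integral_circle_le)
    show "bounded_circle (\<lambda>z. phase g [] z - 1)" by (intro bounded_circle_intros bounded_circle_phase)
    show "norm (phase g [] z - 1) \<le> norm g" if "norm z = 1" for z
      using norm_cis_minus_1[of "Re (g * z)"] abs_Re_le_cmod[of "g * z"] that
      by (simp add: norm_mult phase_def)
  qed
  finally show ?case using assms(1) by simp
next
  case (Cons b bs)
  define C where "C = 2 + norm q * (2 / (1 - norm c))"
  define w where "w = - (1 - (norm c)\<^sup>2) / 4"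
  define S where "S = (\<Sum>b\<leftarrow>bs. (norm b)\<^sup>2)"
  have "w \<le> 0" using norm_c by (simp add: w_def power_le_one)
  then have e: "exp (w * (norm b)\<^sup>2) \<le> 1" by (simp add: mult_nonpos_nonneg)
  have "norm (E (phase g (b # bs)) - of_real (exp (w * ((norm b)\<^sup>2 + S)))) =
      norm ((E (phase g (b # bs)) - of_real (exp (w * (norm b)\<^sup>2)) * E (phase g bs)) +
            of_real (exp (w * (norm b)\<^sup>2)) * (E (phase g bs) - of_real (exp (w * S))))"
    by (simp add: distrib_left exp_add algebra_simps)
  also have "\<dots> \<le> C * \<delta> * (norm b)\<^sup>2 + 1 * (\<delta> + C * \<delta> * S)"
  proof (rule order_trans[OF norm_triangle_ineq], rule add_mono)
    show "norm (E (phase g (b # bs)) - of_real (exp (w * (norm b)\<^sup>2)) * E (phase g bs)) \<le> C * \<delta> * (norm b)\<^sup>2"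
      unfolding w_def C_def by (rule E_phase_step) (use assms Cons.prems in auto)
    show "norm (of_real (exp (w * (norm b)\<^sup>2)) * (E (phase g bs) - of_real (exp (w * S)))) \<le> 1 * (\<delta> + C * \<delta> * S)"
      unfolding norm_mult using e Cons unfolding w_def C_def S_def by (intro mult_mono) auto
  qed
  finally show ?case
    by (simp add: w_def C_def S_def algebra_simps)
qed

end

section \<open>Radial limits and measurability\<close>

text \<open>
  A sequence increasing to 1 along which radial limits can be computed.
\<close>

definition radius :: "nat \<Rightarrow> real" where "radius n = 1 - 1 / (real n + 2)"

lemma radius_bounds: "0 < radius n" "radius n < 1"
  by (auto simp: radius_def field_simps)

lemma radius_tendsto: "radius \<longlonglongrightarrow> 1"
  unfolding radius_def by real_asymp

lemma radius_at_left: "filterlim radius (at_left 1) sequentially"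
  unfolding filterlim_at using radius_tendsto radius_bounds
  by (auto intro!: always_eventually simp: less_imp_neq)

lemma The_False: "(THE x. P x) = (THE x. False)" if "\<And>x. \<not> P x"
  using that by (intro arg_cong[where f = The]) auto

text \<open>
  Convergence as \<open>r\<close> tends to 1, expressed by countably many conditions; this is what makes the set of
  points with a radial limit measurable.
\<close>

lemma tendsto_at_left_1_iff:
  fixes g :: "real \<Rightarrow> complex"
  assumes g: "continuous_on {0..<1} g"
  shows "(g \<longlongrightarrow> l) (at_left 1) \<longleftrightarrow>
    (\<forall>k. \<exists>n. \<forall>x::rat. radius n < of_rat x \<and> of_rat x < (1::real) \<longrightarrow> dist (g (of_rat x)) l \<le> inverse (real (Suc k)))"
    (is "?L \<longleftrightarrow> ?R")
proof
  assume L: ?L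
  show ?R
  proof
    fix k
    have "\<forall>\<^sub>F r in at_left 1. dist (g r) l < inverse (real (Suc k))"
      using L by (rule tendstoD) simp
    then obtain b where b: "b < 1" "\<And>r. b < r \<Longrightarrow> r < 1 \<Longrightarrow> dist (g r) l < inverse (real (Suc k))"
      unfolding eventually_at_left_field by blast
    have "\<forall>\<^sub>F n in sequentially. b < radius n" by (rule order_tendstoD(1)[OF radius_tendsto b(1)])
    then obtain n where "b < radius n" by (meson eventually_happens trivial_limit_sequentially)
    then show "\<exists>n. \<forall>x::rat. radius n < of_rat x \<and> of_rat x < (1::real) \<longrightarrow> dist (g (of_rat x)) l \<le> inverse (real (Suc k))"
      using b(2) by (intro exI[of _ n]) (auto intro!: less_imp_le)
  qed
next
  assume R: ?R
  show ?L
  proof (rule tendstoI)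
    fix e :: real assume "e > 0"
    then obtain k where k: "inverse (real (Suc k)) < e" using reals_Archimedean by blast
    obtain n where n: "\<And>x::rat. radius n < of_rat x \<Longrightarrow> of_rat x < (1::real) \<Longrightarrow> dist (g (of_rat x)) l \<le> inverse (real (Suc k))"
      using R by blast
    have "dist (g r) l < e" if r: "radius n < r" "r < 1" for r
    proof (rule ccontr)
      assume "\<not> dist (g r) l < e"
      then have gr: "inverse (real (Suc k)) < dist (g r) l" using k by simp
      have "continuous_on {radius n<..<1} (\<lambda>r. dist (g r) l)"
        using radius_bounds(1)[of n] by (intro continuous_intros continuous_on_subset[OF g]) auto
      then have "open ((\<lambda>r. dist (g r) l) -` {inverse (real (Suc k))<..} \<inter> {radius n<..<1})"
        by (simp add: continuous_on_open_vimage)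
      moreover have "r \<in> (\<lambda>r. dist (g r) l) -` {inverse (real (Suc k))<..} \<inter> {radius n<..<1}"
        using r gr by simp
      ultimately obtain d where d: "d > 0" "ball r d \<subseteq> (\<lambda>r. dist (g r) l) -` {inverse (real (Suc k))<..} \<inter> {radius n<..<1}"
        unfolding open_contains_ball by blast
      obtain x :: rat where "r < of_rat x" "of_rat x < r + d"
        using of_rat_dense[of r "r + d"] d by auto
      then have "of_rat x \<in> ball r d" by (simp add: dist_real_def)
      with d(2) have "inverse (real (Suc k)) < dist (g (of_rat x)) l" "radius n < of_rat x" "of_rat x < (1::real)"
        by auto
      with n[of x] show False by simp
    qed
    then show "\<forall>\<^sub>F r in at_left 1. dist (g r) l < e"
      unfolding eventually_at_left_field using radius_bounds(2)[of n] by blast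
  qed
qed

context
  fixes f :: "complex \<Rightarrow> complex"
  assumes holf: "f holomorphic_on ball 0 1" and fball: "f ` ball 0 1 \<subseteq> ball 0 1"
begin

abbreviation disc_borel :: "complex measure" where
  "disc_borel \<equiv> restrict_space borel (cball 0 1)"

definition radial_lim :: "complex \<Rightarrow> complex" where
  "radial_lim z = lim (\<lambda>n. f (of_real (radius n) * z))"

definition radial_set :: "complex set" where
  "radial_set = {z \<in> cball 0 1. ((\<lambda>r. f (of_real r * z)) \<longlongrightarrow> radial_lim z) (at_left 1)}"

lemma f_continuous: "continuous_on (ball 0 1) f"
  using holf by (rule holomorphic_on_imp_continuous_on)

lemma scaled_in_ball: "norm z \<le> 1 \<Longrightarrow> 0 \<le> r \<Longrightarrow> r < 1 \<Longrightarrow> of_real r * z \<in> ball (0 :: complex) 1"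
  using mult_left_mono[of "norm z" 1 r] by (simp add: norm_mult)

lemma f_scaled_measurable:
  assumes "0 \<le> r" "r < 1"
  shows "(\<lambda>z. f (of_real r * z)) \<in> borel_measurable disc_borel"
  by (intro borel_measurable_continuous_on_restrict continuous_on_compose2[OF f_continuous])
     (use assms scaled_in_ball in \<open>auto intro!: continuous_intros\<close>)

lemma radial_lim_measurable: "radial_lim \<in> borel_measurable disc_borel"
  unfolding radial_lim_def[abs_def]
  by (intro borel_measurable_lim_metric f_scaled_measurable less_imp_le radius_bounds)

lemma radial_set_measurable: "radial_set \<in> sets disc_borel"
proof -
  have "radial_set = {z \<in> space disc_borel. \<forall>k. \<exists>n. \<forall>x::rat. radius n < of_rat x \<and> of_rat x < (1::real) \<longrightarrow>
           dist (f (of_real (of_rat x) * z)) (radial_lim z) \<le> inverse (real (Suc k))}"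
  proof -
    have "continuous_on {0..<1} (\<lambda>r. f (of_real r * z))" if "z \<in> cball 0 1" for z
      by (rule continuous_on_compose2[OF f_continuous])
         (use that scaled_in_ball[of z] in \<open>auto intro!: continuous_intros\<close>)
    note tendsto_at_left_1_iff[OF this]
    then show ?thesis unfolding radial_set_def by (auto simp: space_restrict_space)
  qed
  also have "\<dots> \<in> sets disc_borel"
  proof (intro sets.sets_Collect_countable_All sets.sets_Collect_countable_Ex)
    fix k n and x :: rat
    show "{z \<in> space disc_borel. radius n < of_rat x \<and> of_rat x < (1::real) \<longrightarrow>
           dist (f (of_real (of_rat x) * z)) (radial_lim z) \<le> inverse (real (Suc k))} \<in> sets disc_borel"
    proof (cases "radius n < of_rat x \<and> of_rat x < (1::real)")
      case True
      then have "0 \<le> (of_rat x :: real)" using radius_bounds(1)[of n] by linarith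
      then have [measurable]: "(\<lambda>z. f (of_real (of_rat x) * z)) \<in> borel_measurable disc_borel"
        using True by (intro f_scaled_measurable) auto
      note [measurable] = radial_lim_measurable
      have "{z \<in> space disc_borel. dist (f (of_real (of_rat x) * z)) (radial_lim z) \<le> inverse (real (Suc k))} \<in> sets disc_borel"
        by measurable
      then show ?thesis using True by simp
    next
      case False
      then have "{z \<in> space disc_borel. radius n < of_rat x \<and> of_rat x < (1::real) \<longrightarrow>
           dist (f (of_real (of_rat x) * z)) (radial_lim z) \<le> inverse (real (Suc k))} = space disc_borel"
        by blast
      then show ?thesis by (simp only: sets.top)
    qed
  qed
  finally show ?thesis .
qed

lemma radial_limit_unique:
  assumes "((\<lambda>r. f (of_real r * z)) \<longlongrightarrow> w) (at_left 1)"
  shows "radial_lim z = w" "boundary_function f z = w"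
proof -
  show "radial_lim z = w"
    unfolding radial_lim_def using filterlim_compose[OF assms radius_at_left] by (rule limI)
  show "boundary_function f z = w"
    unfolding boundary_function_def by (rule tendsto_Lim[OF _ assms]) simp
qed

text \<open>
  At every point of the closed disc without radial limit, \<open>boundary_function\<close> takes one and the same
  value, since the unspecified value does not depend on the point.
\<close>

lemma boundary_function_eq:
  assumes "z \<in> cball 0 1"
  shows "boundary_function f z = (if z \<in> radial_set then radial_lim z else (THE w. False))"
proof (cases "z \<in> radial_set")
  case True
  then show ?thesis using radial_limit_unique(2)[of z "radial_lim z"] by (simp add: radial_set_def)
next
  case False
  then have "\<not> ((\<lambda>r. f (of_real r * z)) \<longlongrightarrow> w) (at_left 1)" for w
    using radial_limit_unique(1)[of z w] assms by (auto simp: radial_set_def)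
  then have "boundary_function f z = (THE w. False)"
    unfolding boundary_function_def Topological_Spaces.Lim_def by (rule The_False)
  then show ?thesis using False by simp
qed

lemma radial_lim_in_cball: "z \<in> radial_set \<Longrightarrow> radial_lim z \<in> cball 0 1"
proof -
  assume "z \<in> radial_set"
  then have z: "norm z \<le> 1" and lim: "((\<lambda>r. f (of_real r * z)) \<longlongrightarrow> radial_lim z) (at_left 1)"
    by (auto simp: radial_set_def)
  show "radial_lim z \<in> cball 0 1"
  proof (rule Lim_in_closed_set[OF closed_cball _ trivial_limit_sequentially filterlim_compose[OF lim radius_at_left]])
    show "\<forall>\<^sub>F n in sequentially. f (of_real (radius n) * z) \<in> cball 0 1"
    proof (intro always_eventually allI)
      fix n
      have "of_real (radius n) * z \<in> ball 0 1"
        by (rule scaled_in_ball[OF z]) (use radius_bounds[of n] in auto)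
      then have "f (of_real (radius n) * z) \<in> ball 0 1" using fball by blast
      then show "f (of_real (radius n) * z) \<in> cball 0 1" by simp
    qed
  qed
qed

text \<open>
  An orbit may leave the circle on a null set, but as long as radial limits exist it stays in the closed disc,
  where \<open>boundary_function\<close> is Borel.  At the first point without radial limit it moves to a
  constant, from where the rest of the orbit is independent of the starting point.
\<close>

lemma iterate_measurable_disc: "(boundary_function f ^^ n) \<in> borel_measurable disc_borel"
proof (induction n)
  case 0
  show ?case by (simp add: measurable_restrict_space1)
next
  case (Suc n)
  define w where "w z = (if z \<in> radial_set then radial_lim z else 0)" for z
  have "w \<in> borel_measurable disc_borel"
    unfolding w_def by (intro measurable_If_set radial_lim_measurable borel_measurable_const)
       (use radial_set_measurable sets.sets_into_space[OF radial_set_measurable] in \<open>auto simp: Int_absorb2\<close>)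
  then have w: "w \<in> disc_borel \<rightarrow>\<^sub>M disc_borel"
    using radial_lim_in_cball by (intro measurable_restrict_space2) (auto simp: w_def)
  have "(\<lambda>z. if z \<in> radial_set then (boundary_function f ^^ n) (w z) else (boundary_function f ^^ n) (THE w. False)) \<in> borel_measurable disc_borel"
    by (intro measurable_If_set measurable_compose[OF w Suc] borel_measurable_const)
       (use radial_set_measurable sets.sets_into_space[OF radial_set_measurable] in \<open>auto simp: Int_absorb2\<close>)
  also have "?this \<longleftrightarrow> (boundary_function f ^^ Suc n) \<in> borel_measurable disc_borel"
    by (intro measurable_cong)
       (auto simp: space_restrict_space boundary_function_eq w_def funpow_swap1[of "boundary_function f"])
  finally show ?case .
qed

lemma disc_to_circle: "g \<in> borel_measurable disc_borel \<Longrightarrow> g \<in> borel_measurable circle_measure"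
  using measurable_restrict_mono[of g borel "cball 0 1" borel "sphere 0 1"]
    measurable_cong_sets[OF sets_circle_measure refl, of borel] sphere_cball[of 0 1] by blast

lemma iterate_measurable: "(boundary_function f ^^ n) \<in> borel_measurable circle_measure"
  by (rule disc_to_circle[OF iterate_measurable_disc])

definition unimodular_set :: "complex set" where
  "unimodular_set = {z \<in> sphere 0 1. \<exists>w. norm w = 1 \<and> ((\<lambda>r. f (of_real r * z)) \<longlongrightarrow> w) (at_left 1)}"

text \<open>
  The boundary function, altered on a null set so as to map the circle to itself.
\<close>

definition circle_map :: "complex \<Rightarrow> complex" where
  "circle_map z = (if z \<in> unimodular_set then boundary_function f z else 1)"

lemma unimodular_set_eq: "unimodular_set = {z \<in> space circle_measure. z \<in> radial_set \<and> norm (radial_lim z) = 1}"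
proof (intro set_eqI iffI)
  fix z assume "z \<in> unimodular_set"
  then obtain w where "norm z = 1" "norm w = 1" "((\<lambda>r. f (of_real r * z)) \<longlongrightarrow> w) (at_left 1)"
    by (auto simp: unimodular_set_def)
  with radial_limit_unique(1)[OF this(3)] show "z \<in> {z \<in> space circle_measure. z \<in> radial_set \<and> norm (radial_lim z) = 1}"
    by (simp add: radial_set_def)
next
  fix z assume "z \<in> {z \<in> space circle_measure. z \<in> radial_set \<and> norm (radial_lim z) = 1}"
  then show "z \<in> unimodular_set"
    unfolding unimodular_set_def radial_set_def by auto
qed

lemma unimodular_set_measurable: "unimodular_set \<in> sets circle_measure"
proof -
  have [measurable]: "radial_lim \<in> borel_measurable circle_measure"
    by (rule disc_to_circle[OF radial_lim_measurable])
  have "(indicator radial_set :: complex \<Rightarrow> real) \<in> borel_measurable circle_measure"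
    by (rule disc_to_circle) (intro borel_measurable_indicator radial_set_measurable)
  then have "radial_set \<inter> space circle_measure \<in> sets circle_measure"
    by (simp only: borel_measurable_indicator_iff)
  moreover have "{z \<in> space circle_measure. norm (radial_lim z) = 1} \<in> sets circle_measure"
    by measurable
  moreover have "unimodular_set = (radial_set \<inter> space circle_measure) \<inter> {z \<in> space circle_measure. norm (radial_lim z) = 1}"
    unfolding unimodular_set_eq by auto
  ultimately show ?thesis by auto
qed

lemma circle_map_tendsto:
  assumes "z \<in> unimodular_set"
  shows "((\<lambda>r. f (of_real r * z)) \<longlongrightarrow> circle_map z) (at_left 1)" "norm (circle_map z) = 1"
proof -
  from assms obtain w where w: "norm w = 1" "((\<lambda>r. f (of_real r * z)) \<longlongrightarrow> w) (at_left 1)"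
    by (auto simp: unimodular_set_def)
  with radial_limit_unique(2)[OF w(2)] assms have "circle_map z = w" by (simp add: circle_map_def)
  with w show "((\<lambda>r. f (of_real r * z)) \<longlongrightarrow> circle_map z) (at_left 1)" "norm (circle_map z) = 1"
    by auto
qed

lemma norm_circle_map: "norm (circle_map z) = 1"
  using circle_map_tendsto(2) by (cases "z \<in> unimodular_set") (auto simp: circle_map_def)

lemma circle_map_measurable: "circle_map \<in> circle_measure \<rightarrow>\<^sub>M circle_measure"
proof -
  have "circle_map \<in> borel_measurable circle_measure"
    unfolding circle_map_def
    using iterate_measurable[of 1] unimodular_set_measurable sets.sets_into_space[OF unimodular_set_measurable]
    by (intro measurable_If_set borel_measurable_const) (auto simp: Int_absorb2 simp del: sets.sets_into_space)
  then have "circle_map \<in> circle_measure \<rightarrow>\<^sub>M restrict_space borel (sphere 0 1)"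
    by (intro measurable_restrict_space2) (auto simp: norm_circle_map)
  then show ?thesis by (simp cong: measurable_cong_sets add: sets_circle_measure)
qed

end

section \<open>Conditional moments of the boundary map of an inner function\<close>

lemma circle_power_moment: "(LINT z|circle_measure. z ^ m) = (if m = 0 then 1 else 0)"
proof -
  have "(LINT z|circle_measure. (of_real (1/2) * z) ^ m) = (0 :: complex) ^ m"
    by (rule circle_mean_value[of "\<lambda>z. z ^ m" "1/2"]) (auto intro!: holomorphic_intros)
  then have "(1/2) ^ m * (LINT z|circle_measure. z ^ m) = (0 :: complex) ^ m"
    unfolding power_mult_distrib integral_mult_right_zero by simp
  then show ?thesis by (cases "m = 0") (auto simp: power_0_left)
qed

lemma power_cnj_cancel:
  assumes "norm z = 1"
  shows "j \<le> k \<Longrightarrow> z ^ k * cnj z ^ j = z ^ (k - j)" "j \<le> k \<Longrightarrow> z ^ j * cnj z ^ k = cnj z ^ (k - j)"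
proof -
  have "z * cnj z = 1" using complex_norm_square[of z] assms by simp
  then have *: "z ^ j * cnj z ^ j = 1" for j by (metis power_mult_distrib power_one)
  assume "j \<le> k"
  then obtain d where d: "k = j + d" using le_Suc_ex by blast
  show "z ^ k * cnj z ^ j = z ^ (k - j)" "z ^ j * cnj z ^ k = cnj z ^ (k - j)"
    using *[of j] by (simp_all add: d power_add mult_ac)
qed

lemma circle_mixed_moment:
  "(LINT z|circle_measure. z ^ j * cnj z ^ k) = (if j = k then 1 else 0)"
proof (cases "k \<le> j")
  case True
  then have "(LINT z|circle_measure. z ^ j * cnj z ^ k) = (LINT z|circle_measure. z ^ (j - k))"
    by (intro Bochner_Integration.integral_cong) (auto simp: power_cnj_cancel)
  then show ?thesis using True by (simp add: circle_power_moment)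
next
  case False
  then have "(LINT z|circle_measure. z ^ j * cnj z ^ k) = (LINT z|circle_measure. cnj (z ^ (k - j)))"
    by (intro Bochner_Integration.integral_cong) (auto simp: power_cnj_cancel)
  also have "\<dots> = cnj (LINT z|circle_measure. z ^ (k - j))" by (rule Bochner_Integration.integral_cnj)
  finally show ?thesis using False by (simp add: circle_power_moment)
qed

text \<open>
  On the circle a mixed power \<open>z ^ j * cnj z ^ k\<close> is a power of \<open>z\<close> or of \<open>cnj z\<close>, and conjugation turns the
  latter case into the former.
\<close>

lemma mixed_moments_eqI:
  assumes T: "\<And>z. norm z = 1 \<Longrightarrow> norm (T z) = 1"
    and pos: "\<And>n. (LINT z|circle_measure. u z * T z ^ n) = (LINT z|circle_measure. v z * z ^ n)"
    and neg: "\<And>n. (LINT z|circle_measure. cnj (u z) * T z ^ n) = (LINT z|circle_measure. cnj (v z) * z ^ n)"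
  shows "(LINT z|circle_measure. u z * (T z ^ j * cnj (T z) ^ k)) =
         (LINT z|circle_measure. v z * (z ^ j * cnj z ^ k))"
proof (cases "k \<le> j")
  case True
  have "(LINT z|circle_measure. u z * (T z ^ j * cnj (T z) ^ k)) = (LINT z|circle_measure. u z * T z ^ (j - k))"
    using True by (intro Bochner_Integration.integral_cong) (auto simp: power_cnj_cancel T)
  also note pos
  also have "(LINT z|circle_measure. v z * z ^ (j - k)) = (LINT z|circle_measure. v z * (z ^ j * cnj z ^ k))"
    using True by (intro Bochner_Integration.integral_cong) (auto simp: power_cnj_cancel)
  finally show ?thesis .
next
  case False
  then have k: "j \<le> k" by simp
  have "(LINT z|circle_measure. u z * (T z ^ j * cnj (T z) ^ k)) = (LINT z|circle_measure. cnj (cnj (u z) * T z ^ (k - j)))"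
    using k by (intro Bochner_Integration.integral_cong) (auto simp: power_cnj_cancel T)
  also have "\<dots> = (LINT z|circle_measure. cnj (cnj (v z) * z ^ (k - j)))"
    unfolding Bochner_Integration.integral_cnj neg ..
  also have "\<dots> = (LINT z|circle_measure. v z * (z ^ j * cnj z ^ k))"
    using k by (intro Bochner_Integration.integral_cong) (auto simp: power_cnj_cancel)
  finally show ?thesis .
qed

context
  fixes f :: "complex \<Rightarrow> complex"
  assumes inner: "inner_function f" and f0: "f 0 = 0"
begin

lemma holf: "f holomorphic_on ball 0 1" and fball: "f ` ball 0 1 \<subseteq> ball 0 1"
  using inner by (auto simp: inner_function_def)

abbreviation "T \<equiv> circle_map f"

lemma AE_unimodular: "AE z in circle_measure. z \<in> unimodular_set f"
  using inner AE_space unfolding inner_function_def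
  by (auto simp: unimodular_set_def[OF holf fball] elim: eventually_elim2)

lemma boundary_measurable: "T \<in> circle_measure \<rightarrow>\<^sub>M circle_measure"
  by (rule circle_map_measurable[OF holf fball])

lemma boundary_borel: "T \<in> borel_measurable circle_measure"
  using measurable_compose[OF boundary_measurable circle_id] by simp

lemma norm_f: "norm z < 1 \<Longrightarrow> norm (f z) < 1"
  using fball by (auto simp: image_subset_iff)

lemma f_scaled_borel: "(\<lambda>z. f (of_real (radius n) * z)) \<in> borel_measurable circle_measure"
  by (rule disc_to_circle[OF holf fball f_scaled_measurable[OF holf fball]]) (use radius_bounds[of n] in auto)

lemma boundary_integral_limit:
  assumes "bounded_circle u"
  shows "(\<lambda>n. LINT z|circle_measure. u z * f (of_real (radius n) * z) ^ k)
           \<longlonglongrightarrow> (LINT z|circle_measure. u z * T z ^ k)"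
proof -
  from assms obtain B where [measurable]: "u \<in> borel_measurable circle_measure"
    and B: "\<And>z. norm z = 1 \<Longrightarrow> norm (u z) \<le> B" by (auto simp: bounded_circle_def)
  note [measurable] = boundary_borel f_scaled_borel
  show ?thesis
  proof (rule integral_dominated_convergence[where w = "\<lambda>_. B"])
    show "AE z in circle_measure. (\<lambda>n. u z * f (of_real (radius n) * z) ^ k) \<longlonglongrightarrow> u z * T z ^ k"
      using AE_unimodular
    proof eventually_elim
      case (elim z)
      show ?case
        by (intro tendsto_intros filterlim_compose[OF circle_map_tendsto(1)[OF holf fball elim] radius_at_left])
    qed
    show "AE z in circle_measure. norm (u z * f (of_real (radius n) * z) ^ k) \<le> B" for n
    proof (intro AE_I2)
      fix z assume "z \<in> space circle_measure"
      then have z: "norm z = 1" by simp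
      have "norm (f (of_real (radius n) * z)) \<le> 1"
        using norm_f[of "of_real (radius n) * z"] radius_bounds[of n] z by (simp add: norm_mult)
      then have "norm (u z) * norm (f (of_real (radius n) * z)) ^ k \<le> B * 1"
        using B[OF z] order_trans[OF norm_ge_zero B[OF z]] by (intro mult_mono power_le_one) auto
      then show "norm (u z * f (of_real (radius n) * z) ^ k) \<le> B" by (simp add: norm_mult norm_power)
    qed
  qed auto
qed

lemma boundary_moment_analytic:
  "(LINT z|circle_measure. z ^ m * T z ^ k) = (if m = 0 \<and> k = 0 then 1 else 0)"
proof -
  have "(LINT z|circle_measure. z ^ m * f (of_real (radius n) * z) ^ k) = (if m = 0 \<and> k = 0 then 1 else 0)" for n
  proof -
    have "(LINT z|circle_measure. (of_real (radius n) * z) ^ m * f (of_real (radius n) * z) ^ k) = 0 ^ m * f 0 ^ k"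
      by (rule circle_mean_value[of "\<lambda>z. z ^ m * f z ^ k"]) (auto intro!: holomorphic_intros holf radius_bounds)
    then have "of_real (radius n) ^ m * (LINT z|circle_measure. z ^ m * f (of_real (radius n) * z) ^ k) = 0 ^ m * 0 ^ k"
      by (simp add: power_mult_distrib f0 mult.assoc)
    then show ?thesis using radius_bounds(1)[of n] by (cases "m = 0"; cases "k = 0") (auto simp: power_0_left)
  qed
  then show ?thesis
    using boundary_integral_limit[of "\<lambda>z. z ^ m" k] bounded_circle_intros
    by (simp add: LIMSEQ_const_iff)
qed

text \<open>
  For \<open>k \<ge> j\<close> write \<open>f z = z * h z\<close>; on a circle of radius \<open>r\<close> the factor \<open>cnj z ^ j\<close> cancels
  against \<open>z ^ k\<close>, and what remains is holomorphic with value \<open>0\<close> or \<open>h 0 ^ k\<close> at the centre, where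
  \<open>h 0 = f'(0)\<close>.
\<close>

lemma boundary_moment_antianalytic:
  assumes k: "j \<le> k" "1 \<le> k"
  shows "(LINT z|circle_measure. cnj z ^ j * T z ^ k) = (if j = k then deriv f 0 ^ k else 0)"
proof -
  obtain h where h: "h holomorphic_on ball 0 1" and fh: "\<And>z. norm z < 1 \<Longrightarrow> f z = z * h z"
    and h0: "deriv f 0 = h 0"
    using Schwarz3[OF holf f0] by blast
  have "(LINT z|circle_measure. cnj z ^ j * f (of_real (radius n) * z) ^ k) = of_real (radius n) ^ j * (if j = k then h 0 ^ k else 0)" for n
  proof -
    let ?r = "of_real (radius n) :: complex"
    have "(LINT z|circle_measure. cnj z ^ j * f (?r * z) ^ k) =
        (LINT z|circle_measure. ?r ^ j * ((?r * z) ^ (k - j) * h (?r * z) ^ k))"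
    proof (intro Bochner_Integration.integral_cong refl)
      fix z assume "z \<in> space circle_measure"
      then have z: "norm z = 1" by simp
      have "f (?r * z) = ?r * z * h (?r * z)"
        using radius_bounds[of n] z by (intro fh) (simp add: norm_mult)
      then have "cnj z ^ j * f (?r * z) ^ k = ?r ^ k * (z ^ k * cnj z ^ j) * h (?r * z) ^ k"
        by (simp add: power_mult_distrib mult_ac)
      also have "?r ^ k = ?r ^ j * ?r ^ (k - j)" using k by (simp flip: power_add)
      finally show "cnj z ^ j * f (?r * z) ^ k = ?r ^ j * ((?r * z) ^ (k - j) * h (?r * z) ^ k)"
        using power_cnj_cancel(1)[OF z k(1)] by (simp add: power_mult_distrib mult_ac)
    qed
    also have "\<dots> = ?r ^ j * (0 ^ (k - j) * h 0 ^ k)"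
      unfolding integral_mult_right_zero
      by (subst circle_mean_value[of "\<lambda>z. z ^ (k - j) * h z ^ k" "radius n"])
         (auto intro!: holomorphic_intros h radius_bounds)
    finally show ?thesis using k by (auto simp: power_0_left)
  qed
  then have "(\<lambda>n. of_real (radius n) ^ j * (if j = k then h 0 ^ k else 0)) \<longlonglongrightarrow> (LINT z|circle_measure. cnj z ^ j * T z ^ k)"
    using boundary_integral_limit[of "\<lambda>z. cnj z ^ j" k] bounded_circle_power[OF bounded_circle_cnj[OF bounded_circle_id]]
    by simp
  moreover have "(\<lambda>n. of_real (radius n) ^ j * (if j = k then h 0 ^ k else 0)) \<longlonglongrightarrow> of_real 1 ^ j * (if j = k then h 0 ^ k else 0)"
    by (intro tendsto_intros radius_tendsto)
  ultimately have "(LINT z|circle_measure. cnj z ^ j * T z ^ k) = of_real 1 ^ j * (if j = k then h 0 ^ k else 0)"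
    by (rule LIMSEQ_unique)
  then show ?thesis by (simp add: h0)
qed

lemma boundary_preserved: "distr circle_measure circle_measure T = circle_measure"
proof (rule circle_measure_preservedI[OF boundary_measurable])
  fix j k
  have "(LINT z|circle_measure. 1 * (T z ^ j * cnj (T z) ^ k)) = (LINT z|circle_measure. 1 * (z ^ j * cnj z ^ k))"
    by (rule mixed_moments_eqI)
       (use norm_circle_map[OF holf fball] boundary_moment_analytic[of 0] in \<open>auto simp: circle_power_moment\<close>)
  then show "(LINT z|circle_measure. T z ^ j * cnj (T z) ^ k) = (LINT z|circle_measure. z ^ j * cnj z ^ k)"
    by simp
qed

lemma boundary_first_moment:
  assumes "integrable circle_measure G"
  shows "(LINT z|circle_measure. z * G (T z)) = cnj (deriv f 0) * (LINT z|circle_measure. z * G z)"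
proof -
  have d: "norm (deriv f 0) \<le> 1" using Schwarz_Lemma(2)[OF holf f0 norm_f, of 0] by simp
  have "(LINT z|circle_measure. z * G (T z)) = (LINT z|circle_measure. cnj (deriv f 0) * z * G z)"
  proof (rule integral_of_factor[OF boundary_measurable _ _ _ _ _ boundary_preserved assms, where B = 1])
    show "(LINT z|circle_measure. z * (T z ^ j * cnj (T z) ^ k)) =
        (LINT z|circle_measure. cnj (deriv f 0) * z * (z ^ j * cnj z ^ k))" for j k
    proof (rule mixed_moments_eqI)
      show "(LINT z|circle_measure. z * T z ^ n) = (LINT z|circle_measure. cnj (deriv f 0) * z * z ^ n)" for n
        using boundary_moment_analytic[of 1 n] circle_power_moment[of "Suc n"] by (simp add: mult.assoc)
      show "(LINT z|circle_measure. cnj z * T z ^ n) = (LINT z|circle_measure. cnj (cnj (deriv f 0) * z) * z ^ n)" for n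
        using boundary_moment_antianalytic[of 1 n] circle_mixed_moment[of n 1] circle_mixed_moment[of 0 1]
        by (cases "n = 0") (auto simp: mult.assoc mult.commute[of "cnj _"])
    qed (use norm_circle_map[OF holf fball] in auto)
  qed (use d in \<open>auto intro!: borel_measurable_times circle_id simp: norm_mult\<close>)
  then show ?thesis by (simp add: mult.assoc)
qed

text \<open>
  The Fourier coefficients of \<open>cnj z ^ 2\<close> against \<open>T ^ n\<close> vanish except for \<open>n = 2\<close>, where the value is
  \<open>f'(0)\<^sup>2\<close>, and \<open>n = 1\<close>, where it is \<open>cnj q\<close> (the Taylor coefficient \<open>f''(0) / 2\<close>).
\<close>

lemma boundary_second_moment:
  assumes "integrable circle_measure G"
  defines "q \<equiv> cnj (LINT z|circle_measure. cnj z ^ 2 * T z)"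
  shows "(LINT z|circle_measure. z\<^sup>2 * G (T z)) =
           q * (LINT z|circle_measure. z * G z) + (cnj (deriv f 0))\<^sup>2 * (LINT z|circle_measure. z\<^sup>2 * G z)"
proof -
  let ?v = "\<lambda>z. q * z + (cnj (deriv f 0))\<^sup>2 * z\<^sup>2"
  have v: "bounded_circle ?v" "bounded_circle (\<lambda>z. z\<^sup>2)" by (intro bounded_circle_intros)+
  from v(1) obtain B where B: "\<And>z. norm z = 1 \<Longrightarrow> norm (?v z) \<le> B" by (auto simp: bounded_circle_def)
  have "(LINT z|circle_measure. z\<^sup>2 * G (T z)) = (LINT z|circle_measure. ?v z * G z)"
  proof (rule integral_of_factor[OF boundary_measurable _ _ _ _ _ boundary_preserved assms(1), where B = "max 1 B"])
    show "(LINT z|circle_measure. z\<^sup>2 * (T z ^ j * cnj (T z) ^ k)) = (LINT z|circle_measure. ?v z * (z ^ j * cnj z ^ k))" for j k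
    proof (rule mixed_moments_eqI)
      show "(LINT z|circle_measure. z\<^sup>2 * T z ^ n) = (LINT z|circle_measure. ?v z * z ^ n)" for n
      proof -
        have "(LINT z|circle_measure. ?v z * z ^ n) =
            (LINT z|circle_measure. q * z ^ Suc n + (cnj (deriv f 0))\<^sup>2 * z ^ (2 + n))"
          by (simp add: algebra_simps power_add power2_eq_square)
        also have "\<dots> = q * (LINT z|circle_measure. z ^ Suc n) + (cnj (deriv f 0))\<^sup>2 * (LINT z|circle_measure. z ^ (2 + n))"
          by (subst Bochner_Integration.integral_add) (auto simp only: integral_mult_right_zero intro!: bounded_circle_integrable bounded_circle_intros)
        also have "\<dots> = 0" unfolding circle_power_moment by simp
        finally show ?thesis using boundary_moment_analytic[of 2 n] by simp
      qed
      show "(LINT z|circle_measure. cnj (z\<^sup>2) * T z ^ n) = (LINT z|circle_measure. cnj (?v z) * z ^ n)" for n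
      proof -
        have "(LINT z|circle_measure. cnj (?v z) * z ^ n) =
            (LINT z|circle_measure. cnj q * (z ^ n * cnj z ^ 1) + (deriv f 0)\<^sup>2 * (z ^ n * cnj z ^ 2))"
          by (simp add: algebra_simps)
        also have "\<dots> = cnj q * (LINT z|circle_measure. z ^ n * cnj z ^ 1) + (deriv f 0)\<^sup>2 * (LINT z|circle_measure. z ^ n * cnj z ^ 2)"
          by (subst Bochner_Integration.integral_add) (auto simp only: integral_mult_right_zero intro!: bounded_circle_integrable bounded_circle_intros)
        also have "\<dots> = (if n = 1 then cnj q else if n = 2 then (deriv f 0)\<^sup>2 else 0)"
          unfolding circle_mixed_moment by simp
        also have "\<dots> = (LINT z|circle_measure. cnj z ^ 2 * T z ^ n)"
        proof -
          consider "n = 0" | "n = 1" | "2 \<le> n" by linarith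
          then show ?thesis
          proof cases
            case 1 then show ?thesis using circle_mixed_moment[of 0 2] by simp
          next
            case 2 then show ?thesis by (simp add: q_def)
          next
            case 3 then show ?thesis using boundary_moment_antianalytic[of 2 n] by auto
          qed
        qed
        finally show ?thesis by simp
      qed
    qed (use norm_circle_map[OF holf fball] in auto)
    show "norm (?v z) \<le> max 1 B" if "norm z = 1" for z using B[OF that] by simp
  qed (use v in \<open>auto simp: bounded_circle_def norm_power\<close>)
  also have "\<dots> = (LINT z|circle_measure. q * (z * G z) + (cnj (deriv f 0))\<^sup>2 * (z\<^sup>2 * G z))"
    by (simp add: algebra_simps)
  also have "\<dots> = q * (LINT z|circle_measure. z * G z) + (cnj (deriv f 0))\<^sup>2 * (LINT z|circle_measure. z\<^sup>2 * G z)"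
  proof (subst Bochner_Integration.integral_add)
    have i: "integrable circle_measure (\<lambda>z. z ^ n * G z)" for n
      by (rule Bochner_Integration.integrable_bound[OF assms(1)
              borel_measurable_times[OF borel_measurable_power[OF circle_id] borel_measurable_integrable[OF assms(1)]]])
         (auto intro!: AE_I2 simp: norm_mult norm_power)
    show "integrable circle_measure (\<lambda>z. q * (z * G z))" "integrable circle_measure (\<lambda>z. (cnj (deriv f 0))\<^sup>2 * (z\<^sup>2 * G z))"
      using i[of 1] i[of 2] by (auto intro: integrable_mult_right)
  qed simp
  finally show ?thesis .
qed

lemma circle_factor_inner:
  assumes "\<not> disc_rotation f"
  shows "circle_factor T (cnj (deriv f 0)) (cnj (LINT z|circle_measure. cnj z ^ 2 * T z))"
proof
  have "norm (deriv f 0) \<le> 1" using Schwarz_Lemma(2)[OF holf f0 norm_f, of 0] by simp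
  moreover have "norm (deriv f 0) \<noteq> 1"
  proof
    assume "norm (deriv f 0) = 1"
    then obtain \<alpha> where "\<forall>z. norm z < 1 \<longrightarrow> f z = \<alpha> * z" "norm \<alpha> = 1"
      using Schwarz_Lemma(3)[OF holf f0 norm_f, of 0] by auto
    then have "disc_rotation f" unfolding disc_rotation_def by (intro exI[of _ \<alpha>]) simp
    with assms show False ..
  qed
  ultimately show "norm (cnj (deriv f 0)) < 1" by simp
qed (use boundary_measurable boundary_preserved boundary_first_moment boundary_second_moment in auto)

text \<open>
  The orbit of almost every point avoids the exceptional null set, because \<open>circle_map\<close> preserves the
  measure.
\<close>

lemma AE_iterates_eq: "AE z in circle_measure. \<forall>n. (boundary_function f ^^ n) z = (T ^^ n) z"
proof -
  have pres: "distr circle_measure circle_measure (T ^^ n) = circle_measure \<and> T ^^ n \<in> circle_measure \<rightarrow>\<^sub>M circle_measure" for n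
  proof (induction n)
    case 0
    show ?case by (simp add: id_def distr_id)
  next
    case (Suc n)
    then have "distr circle_measure circle_measure (T \<circ> (T ^^ n)) = distr (distr circle_measure circle_measure (T ^^ n)) circle_measure T"
      by (intro distr_distr[symmetric] boundary_measurable) auto
    moreover have "T \<circ> (T ^^ n) \<in> circle_measure \<rightarrow>\<^sub>M circle_measure"
      using Suc by (intro measurable_comp[OF _ boundary_measurable]) simp
    ultimately show ?case
      using Suc.IH boundary_preserved by (simp only: funpow.simps simp_thms)
  qed
  have "AE z in circle_measure. (T ^^ n) z \<in> unimodular_set f" for n
  proof -
    have d: "distr circle_measure circle_measure (T ^^ n) = circle_measure"
      and m: "T ^^ n \<in> circle_measure \<rightarrow>\<^sub>M circle_measure"
      using pres[of n] by auto
    have "{z \<in> space circle_measure. z \<in> unimodular_set f} = unimodular_set f"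
      by (auto simp: unimodular_set_def[OF holf fball])
    then have "{z \<in> space circle_measure. z \<in> unimodular_set f} \<in> sets circle_measure"
      using unimodular_set_measurable[OF holf fball] by (simp only:)
    moreover have "AE z in distr circle_measure circle_measure (T ^^ n). z \<in> unimodular_set f"
      unfolding d by (rule AE_unimodular)
    ultimately show ?thesis by (simp only: AE_distr_iff[OF m])
  qed
  then have "AE z in circle_measure. \<forall>n. (T ^^ n) z \<in> unimodular_set f"
    by (simp add: AE_all_countable)
  then show ?thesis
  proof eventually_elim
    case (elim z)
    show ?case
    proof
      fix n show "(boundary_function f ^^ n) z = (T ^^ n) z"
      proof (induction n)
        case (Suc n)
        have "T ((T ^^ n) z) = boundary_function f ((T ^^ n) z)"
          using elim circle_map_def[OF holf fball, of "(T ^^ n) z"] by simp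
        then show ?case using Suc.IH by simp
      qed simp
    qed
  qed
qed

end

section \<open>Characteristic functions of the normalized sums\<close>

text \<open>
  The weights \<open>\<Sum>k=1..n. a k * c ^ (n - k)\<close> of the reverse martingale differences.
\<close>

primrec geometric_sum :: "complex \<Rightarrow> (nat \<Rightarrow> complex) \<Rightarrow> nat \<Rightarrow> complex" where
  "geometric_sum c a 0 = 0"
| "geometric_sum c a (Suc n) = a (Suc n) + c * geometric_sum c a n"

lemma summation_by_geometric_sum:
  "(\<Sum>n=1..N. a n * X n) =
     (\<Sum>m=1..N. geometric_sum c a m * (X m - c * X (Suc m))) + c * geometric_sum c a N * X (Suc N)"
  by (induction N) (simp_all add: algebra_simps)

lemma cnj_geometric_sum:
  "d * cnj (geometric_sum (cnj d) a N) = (\<Sum>k=1..N. d ^ k * cnj (a (Suc N - k)))"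
proof (induction N)
  case (Suc N)
  have "(\<Sum>k=1..Suc N. d ^ k * cnj (a (Suc (Suc N) - k))) =
      d * cnj (a (Suc N)) + (\<Sum>k=1..N. d ^ Suc k * cnj (a (Suc N - k)))"
    by (subst sum.atLeast_Suc_atMost) (auto simp: sum.shift_bounds_cl_Suc_ivl simp del: power_Suc sum.cl_ivl_Suc)
  also have "(\<Sum>k=1..N. d ^ Suc k * cnj (a (Suc N - k))) = d * (\<Sum>k=1..N. d ^ k * cnj (a (Suc N - k)))"
    by (simp add: sum_distrib_left mult.assoc)
  finally show ?case unfolding Suc.IH[symmetric] by (simp add: algebra_simps)
qed simp

lemma norm_add_square: "(norm (x + y :: complex))\<^sup>2 = (norm x)\<^sup>2 + 2 * Re (x * cnj y) + (norm y)\<^sup>2"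
  by (simp add: cmod_power2) (simp add: power2_eq_square algebra_simps)

text \<open>
  Both sides grow by \<open>(norm (b (N + 1)))\<^sup>2 - (norm c)\<^sup>2 * (norm (b N))\<^sup>2\<close> in each step: on the left
  the new terms of the double sum add up to \<open>a (N + 1) * cnj (c * b N)\<close>.
\<close>

lemma sigma_squared_geometric_sum:
  fixes f a
  defines "c \<equiv> cnj (deriv f 0)"
  defines "b \<equiv> geometric_sum c a"
  shows "sigma_squared f a N =
     (1 - (norm c)\<^sup>2) * (\<Sum>m=1..N. (norm (b m))\<^sup>2) + (norm c)\<^sup>2 * (norm (b N))\<^sup>2"
proof (induction N)
  case 0 then show ?case by (simp add: sigma_squared_def b_def)
next
  case (Suc N)
  define d where "d = deriv f 0"
  define W where "W N = (\<Sum>k=1..N. d ^ k * (\<Sum>n=1..N - k. cnj (a n) * a (n + k)))" for N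
  have "W (Suc N) = (\<Sum>k=1..N. d ^ k * (\<Sum>n=1..Suc N - k. cnj (a n) * a (n + k)))"
    by (simp add: W_def)
  also have "\<dots> = (\<Sum>k=1..N. d ^ k * (\<Sum>n=1..N - k. cnj (a n) * a (n + k)) + d ^ k * cnj (a (Suc N - k)) * a (Suc N))"
    by (intro sum.cong refl) (auto simp: Suc_diff_le algebra_simps)
  also have "\<dots> = W N + (\<Sum>k=1..N. d ^ k * cnj (a (Suc N - k))) * a (Suc N)"
    by (simp add: sum.distrib W_def sum_distrib_right)
  also have "(\<Sum>k=1..N. d ^ k * cnj (a (Suc N - k))) = d * cnj (b N)"
    by (simp add: b_def c_def d_def cnj_geometric_sum)
  finally have W: "W (Suc N) = W N + d * cnj (b N) * a (Suc N)" .
  have ss: "sigma_squared f a N = (\<Sum>n=1..N. (norm (a n))\<^sup>2) + 2 * Re (W N)" for N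
    by (simp add: sigma_squared_def W_def d_def)
  have "sigma_squared f a (Suc N) = sigma_squared f a N + (norm (a (Suc N)))\<^sup>2 + 2 * Re (d * cnj (b N) * a (Suc N))"
    unfolding ss W by simp
  also have "d * cnj (b N) * a (Suc N) = a (Suc N) * cnj (c * b N)"
    by (simp add: c_def d_def)
  also have "sigma_squared f a N + (norm (a (Suc N)))\<^sup>2 + 2 * Re (a (Suc N) * cnj (c * b N)) =
      sigma_squared f a N + (norm (b (Suc N)))\<^sup>2 - (norm c)\<^sup>2 * (norm (b N))\<^sup>2"
    by (simp add: b_def norm_add_square norm_mult power_mult_distrib)
  finally show ?case unfolding Suc.IH by (simp add: algebra_simps)
qed

lemma norm_geometric_sum_le:
  assumes c: "norm c < 1" and A: "0 \<le> A" "\<And>k. 1 \<le> k \<Longrightarrow> k \<le> n \<Longrightarrow> norm (a k) \<le> A"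
  shows "norm (geometric_sum c a n) \<le> A / (1 - norm c)"
  using A(2)
proof (induction n)
  case 0 then show ?case using A(1) c by simp
next
  case (Suc n)
  have "norm (geometric_sum c a (Suc n)) \<le> norm (a (Suc n)) + norm c * norm (geometric_sum c a n)"
    by (simp add: norm_triangle_le norm_mult)
  also have "\<dots> \<le> A + norm c * (A / (1 - norm c))"
    using Suc by (intro add_mono mult_left_mono) auto
  also have "\<dots> = A / (1 - norm c)" using c by (simp add: field_simps)
  finally show ?case .
qed

text \<open>
  Inverting the recursion, \<open>a n = b n - c * b (n - 1)\<close>.
\<close>

lemma sum_norm_le_geometric_sum:
  assumes c: "norm c < 1"
  shows "(\<Sum>n=1..N. (norm (a n))\<^sup>2) \<le> 4 * (\<Sum>m=1..N. (norm (geometric_sum c a m))\<^sup>2)"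
proof -
  have "(\<Sum>n=1..N. (norm (a n))\<^sup>2) \<le>
      4 * (\<Sum>m=1..N. (norm (geometric_sum c a m))\<^sup>2) - 2 * (norm (geometric_sum c a N))\<^sup>2"
  proof (induction N)
    case (Suc N)
    let ?b = "geometric_sum c a"
    have "norm (a (Suc N)) = norm (?b (Suc N) - c * ?b N)" by simp
    also have "\<dots> \<le> norm (?b (Suc N)) + norm c * norm (?b N)"
      by (rule order_trans[OF norm_triangle_ineq4]) (simp add: norm_mult)
    also have "\<dots> \<le> norm (?b (Suc N)) + norm (?b N)"
      using c mult_right_mono[of "norm c" 1 "norm (?b N)"] by simp
    finally have "(norm (a (Suc N)))\<^sup>2 \<le> (norm (?b (Suc N)) + norm (?b N))\<^sup>2"
      by (intro power_mono) auto
    also have "\<dots> \<le> 2 * (norm (?b (Suc N)))\<^sup>2 + 2 * (norm (?b N))\<^sup>2"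
      using sum_squares_bound[of "norm (?b (Suc N))" "norm (?b N)"] by (simp add: power2_sum)
    finally show ?case using Suc by simp
  qed simp
  then show ?thesis by (smt (verit) zero_le_power2)
qed

text \<open>
  This turns the growth hypothesis into the Lindeberg condition that no single coefficient contributes
  a positive proportion of the total.  Once the sum exceeds \<open>x n0\<close>, dividing by it instead of by
  its power \<open>p \<le> 1\<close> costs at most the factor \<open>x n0 powr (p - 1)\<close>.
\<close>

lemma sup_over_sum_tendsto_0:
  fixes x :: "nat \<Rightarrow> real"
  assumes x: "\<And>n. 0 \<le> x n" and n0: "1 \<le> n0" "x n0 > 0" and p: "p \<le> 1"
    and lim: "(\<lambda>N. (SUP n\<in>{1..N}. x n) / (\<Sum>n=1..N. x n) powr p) \<longlonglongrightarrow> 0"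
  shows "(\<lambda>N. (SUP n\<in>{1..N}. x n) / (\<Sum>n=1..N. x n)) \<longlonglongrightarrow> 0"
proof (rule tendsto_0_le[OF lim, where K = "x n0 powr (p - 1)"])
  show "\<forall>\<^sub>F N in sequentially. norm ((SUP n\<in>{1..N}. x n) / (\<Sum>n=1..N. x n)) \<le>
      norm ((SUP n\<in>{1..N}. x n) / (\<Sum>n=1..N. x n) powr p) * x n0 powr (p - 1)"
    using eventually_ge_at_top[of n0]
  proof eventually_elim
    case (elim N)
    define S where "S = (\<Sum>n=1..N. x n)"
    define A where "A = (SUP n\<in>{1..N}. x n)"
    have S: "x n0 \<le> S" unfolding S_def using n0 elim x by (intro member_le_sum) auto
    have "x n0 \<le> A" unfolding A_def using n0 elim by (intro cSUP_upper) auto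
    then have A: "A \<ge> 0" using n0 by simp
    have "A / S = A / S powr p * S powr (p - 1)"
      using S n0 by (simp add: powr_diff)
    also have "\<dots> \<le> A / S powr p * x n0 powr (p - 1)"
      using S n0 p A by (intro mult_left_mono powr_mono2') auto
    finally have "norm (A / S) \<le> norm (A / S powr p) * x n0 powr (p - 1)"
      using A S n0 by simp
    then show ?case unfolding A_def S_def .
  qed
qed

context circle_factor
begin

lemma incr_sum_eq_sum:
  "incr_sum g bs z = (\<Sum>i<length bs. bs ! i * incr ((T ^^ i) z)) + g * (T ^^ length bs) z"
proof (induction bs arbitrary: z)
  case (Cons b bs)
  show ?case
    unfolding incr_sum.simps Cons.IH length_Cons
    by (subst sum.lessThan_Suc_shift) (simp add: funpow_swap1)
qed simp

definition scaled_sum :: "(nat \<Rightarrow> complex) \<Rightarrow> complex \<Rightarrow> nat \<Rightarrow> complex \<Rightarrow> complex" where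
  "scaled_sum a s N z = s * (\<Sum>n=1..N. a n * (T ^^ n) z)"

lemma scaled_sum_eq_incr_sum:
  "scaled_sum a s N z =
     incr_sum (s * c * geometric_sum c a N) (map (\<lambda>m. s * geometric_sum c a m) [1..<Suc N]) (T z)"
proof -
  have T1: "(T ^^ i) (T z) = (T ^^ Suc i) z" for i by (simp add: funpow_swap1)
  have "incr_sum (s * c * geometric_sum c a N) (map (\<lambda>m. s * geometric_sum c a m) [1..<Suc N]) (T z) =
     (\<Sum>i<N. s * geometric_sum c a (Suc i) * ((T ^^ Suc i) z - c * (T ^^ Suc (Suc i)) z)) +
       s * c * geometric_sum c a N * (T ^^ Suc N) z"
    unfolding incr_sum_eq_sum T1 incr_def by (simp add: funpow_swap1 del: upt_Suc)
  also have "\<dots> = s * ((\<Sum>m=1..N. geometric_sum c a m * ((T ^^ m) z - c * (T ^^ Suc m) z)) +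
       c * geometric_sum c a N * (T ^^ Suc N) z)"
    by (simp only: distrib_left sum_distrib_left mult.assoc sum.atLeast1_atMost_eq One_nat_def)
  also have "\<dots> = scaled_sum a s N z"
    unfolding scaled_sum_def by (subst summation_by_geometric_sum[of a _ N c]) simp
  finally show ?thesis ..
qed

lemma sum_list_scaled:
  "(\<Sum>b\<leftarrow>map (\<lambda>m. s * x m) [1..<Suc N]. (norm b)\<^sup>2) = (norm s)\<^sup>2 * (\<Sum>m=1..N. (norm (x m :: complex))\<^sup>2)"
  by (simp add: o_def interv_sum_list_conv_sum_set_nat atLeastLessThanSuc_atLeastAtMost
        norm_mult power_mult_distrib sum_distrib_left del: upt_Suc)

lemma bounded_circle_scaled_sum: "bounded_circle (scaled_sum a s N)"
  unfolding scaled_sum_eq_incr_sum[abs_def] by (intro bounded_circle_T bounded_circle_incr_sum)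

lemma E_norm_scaled_sum:
  "(LINT z|circle_measure. (norm (scaled_sum a s N z))\<^sup>2) =
     (norm s)\<^sup>2 * ((1 - (norm c)\<^sup>2) * (\<Sum>m=1..N. (norm (geometric_sum c a m))\<^sup>2) +
                   (norm c)\<^sup>2 * (norm (geometric_sum c a N))\<^sup>2)"
proof -
  define g bs where "g = s * c * geometric_sum c a N"
    and "bs = map (\<lambda>m. s * geometric_sum c a m) [1..<Suc N]"
  have "of_real (LINT z|circle_measure. (norm (scaled_sum a s N z))\<^sup>2) = E (\<lambda>z. of_real ((norm (incr_sum g bs (T z)))\<^sup>2))"
    unfolding scaled_sum_eq_incr_sum g_def bs_def by (rule integral_complex_of_real[symmetric])
  also have "\<dots> = E (\<lambda>z. incr_sum g bs (T z) * cnj (incr_sum g bs (T z)))"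
    by (simp only: complex_norm_square)
  also have "\<dots> = E (\<lambda>z. incr_sum g bs z * cnj (incr_sum g bs z))"
    by (rule E_T[of "\<lambda>z. incr_sum g bs z * cnj (incr_sum g bs z)"]) (intro bounded_circle_intros bounded_circle_incr_sum)
  also have "\<dots> = of_real ((1 - (norm c)\<^sup>2) * (\<Sum>b\<leftarrow>bs. (norm b)\<^sup>2) + (norm g)\<^sup>2)"
    by (rule E_norm_incr_sum_square)
  finally show ?thesis
    unfolding of_real_eq_iff bs_def sum_list_scaled
    by (simp add: g_def norm_mult power_mult_distrib algebra_simps)
qed

text \<open>
  The weights scaled by \<open>cnj t * s N\<close> are bounded by \<open>\<delta> N\<close>, which tends to 0, while the sum of their
  squares stays bounded.  So the error in \<open>E_phase\<close> tends to 0, and the normalization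
  makes the exponent tend to \<open>- (norm t)\<^sup>2 / 2\<close>.
\<close>

theorem scaled_sum_character_tendsto:
  fixes a :: "nat \<Rightarrow> complex" and t :: complex
  defines "b \<equiv> geometric_sum c a"
  defines "\<sigma> \<equiv> \<lambda>N. (1 - (norm c)\<^sup>2) * (\<Sum>m=1..N. (norm (b m))\<^sup>2) + (norm c)\<^sup>2 * (norm (b N))\<^sup>2"
  assumes n0: "1 \<le> n0" "a n0 \<noteq> 0"
    and lim: "(\<lambda>N. (SUP n\<in>{1..N}. (norm (a n))\<^sup>2) / (\<Sum>n=1..N. (norm (a n))\<^sup>2)) \<longlonglongrightarrow> 0"
  shows "(\<lambda>N. E (\<lambda>z. character t (scaled_sum a (of_real (sqrt 2 / sqrt (\<sigma> N))) N z)))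
           \<longlonglongrightarrow> of_real (exp (- (norm t)\<^sup>2 / 2))"
proof -
  define A where "A N = (SUP n\<in>{1..N}. (norm (a n))\<^sup>2)" for N
  define S where "S N = (\<Sum>n=1..N. (norm (a n))\<^sup>2)" for N
  define B where "B N = (\<Sum>m=1..N. (norm (b m))\<^sup>2)" for N
  define k where "k = 1 - (norm c)\<^sup>2"
  have k: "0 < k" "k \<le> 1" using norm_c by (auto simp: k_def power_less_one_iff)
  define s where "s N = sqrt 2 / sqrt (\<sigma> N)" for N
  \<comment> \<open>The weights satisfy \<open>(norm (b m))\<^sup>2 \<le> A N / (1 - norm c)\<^sup>2\<close> and \<open>\<sigma> N \<ge> k * S N / 4\<close>;
    hence \<open>(s N)\<^sup>2 * (norm (b m))\<^sup>2 = 2 / \<sigma> N * (norm (b m))\<^sup>2\<close> is at most \<open>C * (A N / S N)\<close>.\<close>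
  define C where "C = 8 / ((1 - norm c)\<^sup>2 * k)"
  have C: "0 \<le> C" using k by (simp add: C_def)
  define r where "r N = C * (A N / S N)" for N
  have r0: "r \<longlonglongrightarrow> 0"
    unfolding r_def A_def S_def using tendsto_mult_left[OF lim, of C] by simp
  define \<delta> where "\<delta> N = norm t * sqrt (r N)" for N
  have \<delta>0: "\<delta> \<longlonglongrightarrow> 0"
    unfolding \<delta>_def using tendsto_mult_left[OF tendsto_real_sqrt[OF r0], of "norm t"] by simp
  have S: "S N > 0" if "n0 \<le> N" for N
  proof -
    have "(norm (a n0))\<^sup>2 \<le> S N" unfolding S_def using n0 that by (intro member_le_sum) auto
    moreover have "0 < (norm (a n0))\<^sup>2" using n0 by simp
    ultimately show ?thesis by linarith
  qed
  have SB: "S N \<le> 4 * B N" for N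
    unfolding S_def B_def b_def by (rule sum_norm_le_geometric_sum[OF norm_c])
  have \<sigma>_eq: "\<sigma> N = k * B N + (norm c)\<^sup>2 * (norm (b N))\<^sup>2" for N
    by (simp add: \<sigma>_def k_def B_def)
  have \<sigma>: "\<sigma> N \<ge> k * S N / 4" for N
  proof -
    have "k * S N \<le> k * (4 * B N)" using SB k by (intro mult_left_mono) auto
    moreover have "0 \<le> (norm c)\<^sup>2 * (norm (b N))\<^sup>2" by simp
    ultimately show ?thesis unfolding \<sigma>_eq by linarith
  qed
  have \<sigma>pos: "\<sigma> N > 0" if "n0 \<le> N" for N
  proof -
    have "0 < k * S N / 4" using S[OF that] k by simp
    then show ?thesis using \<sigma>[of N] by linarith
  qed
  have s2: "(s N)\<^sup>2 = 2 / \<sigma> N" if "n0 \<le> N" for N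
    using \<sigma>pos[OF that] by (simp add: s_def power_divide)
  have bA: "(norm (b m))\<^sup>2 \<le> A N / (1 - norm c)\<^sup>2" if "n0 \<le> N" "m \<le> N" for N m
  proof -
    have aA: "(norm (a j))\<^sup>2 \<le> A N" if "1 \<le> j" "j \<le> N" for j
      unfolding A_def using that by (intro cSUP_upper) auto
    have A0: "0 \<le> A N" using order_trans[OF zero_le_power2 aA[of n0]] n0 that by simp
    have "norm (a j) \<le> sqrt (A N)" if "1 \<le> j" "j \<le> m" for j
      using aA[of j] that \<open>m \<le> N\<close> by (intro real_le_rsqrt) auto
    then have "norm (b m) \<le> sqrt (A N) / (1 - norm c)"
      unfolding b_def using A0 by (intro norm_geometric_sum_le norm_c) auto
    then have "(norm (b m))\<^sup>2 \<le> (sqrt (A N) / (1 - norm c))\<^sup>2" by (intro power_mono) auto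
    then show ?thesis using A0 by (simp add: power_divide)
  qed
  have sb: "(s N)\<^sup>2 * (norm (b m))\<^sup>2 \<le> r N" if N: "n0 \<le> N" and m: "m \<le> N" for N m
  proof -
    have "(s N)\<^sup>2 * (norm (b m))\<^sup>2 \<le> (2 / (k * S N / 4)) * (A N / (1 - norm c)\<^sup>2)"
      unfolding s2[OF N] using S[OF N] k \<sigma>[of N] \<sigma>pos[OF N] bA[OF N m]
      by (intro mult_mono divide_left_mono mult_pos_pos) auto
    also have "\<dots> = r N" using k by (simp add: r_def C_def)
    finally show ?thesis .
  qed
  have sb': "norm (cnj t * of_real (s N) * b m) \<le> \<delta> N" if N: "n0 \<le> N" and m: "m \<le> N" for N m
  proof -
    have "\<bar>s N\<bar> * norm (b m) = sqrt ((s N)\<^sup>2 * (norm (b m))\<^sup>2)" by (simp add: real_sqrt_mult)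
    also have "\<dots> \<le> sqrt (r N)" using sb[OF N m] by simp
    finally have "norm t * (\<bar>s N\<bar> * norm (b m)) \<le> norm t * sqrt (r N)" by (intro mult_left_mono) auto
    then show ?thesis by (simp add: \<delta>_def norm_mult mult.assoc)
  qed
  define \<tau> where "\<tau> N = cnj t * of_real (s N)" for N
  define bs where "bs N = map (\<lambda>m. \<tau> N * b m) [1..<Suc N]" for N
  define g where "g N = \<tau> N * c * b N" for N
  define v where "v N = (\<Sum>x\<leftarrow>bs N. (norm x)\<^sup>2)" for N
  have char: "E (\<lambda>z. character t (scaled_sum a (of_real (s N)) N z)) = E (phase (g N) (bs N))" for N
  proof -
    have "cnj t * scaled_sum a (of_real (s N)) N z = scaled_sum a (\<tau> N) N z" for z
      by (simp add: scaled_sum_def \<tau>_def)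
    then have "E (\<lambda>z. character t (scaled_sum a (of_real (s N)) N z)) = E (\<lambda>z. phase (g N) (bs N) (T z))"
      unfolding character_def phase_def scaled_sum_eq_incr_sum g_def bs_def b_def by simp
    also have "\<dots> = E (phase (g N) (bs N))" by (rule E_T[OF bounded_circle_phase])
    finally show ?thesis .
  qed
  have v_eq: "v N = (norm t)\<^sup>2 * ((s N)\<^sup>2 * B N)" for N
    unfolding v_def bs_def sum_list_scaled B_def by (simp add: \<tau>_def norm_mult power_mult_distrib mult.assoc)
  \<comment> \<open>The boundary term is the only difference between \<open>\<sigma> N\<close> and \<open>k * B N\<close>; it is negligible.\<close>
  have kB: "k / 4 * ((s N)\<^sup>2 * B N) = 1 / 2 - (norm c)\<^sup>2 / 4 * ((s N)\<^sup>2 * (norm (b N))\<^sup>2)" if N: "n0 \<le> N" for N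
  proof -
    have "(s N)\<^sup>2 * (k * B N + (norm c)\<^sup>2 * (norm (b N))\<^sup>2) = 2"
      unfolding \<sigma>_eq[symmetric] s2[OF N] using \<sigma>pos[OF N] by simp
    then show ?thesis by (simp add: algebra_simps)
  qed
  have sbN: "(\<lambda>N. (s N)\<^sup>2 * (norm (b N))\<^sup>2) \<longlonglongrightarrow> 0"
    by (rule tendsto_0_le[OF r0, where K = 1])
       (use eventually_ge_at_top[of n0] in \<open>eventually_elim, use sb in force\<close>)
  have "(\<lambda>N. 1 / 2 - (norm c)\<^sup>2 / 4 * ((s N)\<^sup>2 * (norm (b N))\<^sup>2)) \<longlonglongrightarrow> 1 / 2 - (norm c)\<^sup>2 / 4 * 0"
    by (intro tendsto_intros sbN)
  then have "(\<lambda>N. 1 / 2 - (norm c)\<^sup>2 / 4 * ((s N)\<^sup>2 * (norm (b N))\<^sup>2)) \<longlonglongrightarrow> 1 / 2"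
    by simp
  then have kBlim: "(\<lambda>N. k / 4 * ((s N)\<^sup>2 * B N)) \<longlonglongrightarrow> 1 / 2"
    by (rule Lim_transform_eventually)
       (rule eventually_mono[OF eventually_ge_at_top[of n0]], simp only: kB)
  have vlim: "(\<lambda>N. k / 4 * v N) \<longlonglongrightarrow> (norm t)\<^sup>2 / 2"
    using tendsto_mult_left[OF kBlim, of "(norm t)\<^sup>2"] by (simp add: v_eq mult_ac)
  have vlim': "v \<longlonglongrightarrow> 4 / k * ((norm t)\<^sup>2 / 2)"
    using tendsto_mult_left[OF vlim, of "4 / k"] k by simp
  define Q where "Q = 2 + norm q * (2 / (1 - norm c))"
  have "(\<lambda>N. \<delta> N + Q * \<delta> N * v N) \<longlonglongrightarrow> 0 + Q * 0 * (4 / k * ((norm t)\<^sup>2 / 2))"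
    by (intro tendsto_intros \<delta>0 vlim')
  then have err0: "(\<lambda>N. \<delta> N + Q * \<delta> N * v N) \<longlonglongrightarrow> 0" by simp
  have "\<forall>\<^sub>F N in sequentially. \<delta> N < 1" by (rule order_tendstoD[OF \<delta>0]) simp
  then have "\<forall>\<^sub>F N in sequentially.
      norm (E (phase (g N) (bs N)) - of_real (exp (- (k / 4 * v N)))) \<le> norm (\<delta> N + Q * \<delta> N * v N) * 1"
    using eventually_ge_at_top[of n0]
  proof eventually_elim
    case (elim N)
    have "norm (g N) \<le> norm (\<tau> N * b N)"
      using norm_c by (simp add: g_def norm_mult mult_left_le mult_right_mono)
    also have "\<dots> \<le> \<delta> N" using sb'[of N N] elim by (simp add: \<tau>_def)
    finally have g: "norm (g N) \<le> \<delta> N" .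
    have bsd: "norm x \<le> \<delta> N" if "x \<in> set (bs N)" for x
      using that sb'[of N] elim by (auto simp: bs_def \<tau>_def simp del: upt_Suc)
    have "norm (E (phase (g N) (bs N)) - of_real (exp (- k / 4 * v N))) \<le> \<delta> N + Q * \<delta> N * v N"
      unfolding k_def v_def Q_def using E_phase[of "g N" "\<delta> N" "bs N"] g bsd elim by simp
    then show ?case by simp
  qed
  then have "(\<lambda>N. E (phase (g N) (bs N)) - of_real (exp (- (k / 4 * v N)))) \<longlonglongrightarrow> 0"
    by (rule tendsto_0_le[OF err0])
  moreover have "(\<lambda>N. of_real (exp (- (k / 4 * v N))) :: complex) \<longlonglongrightarrow> of_real (exp (- ((norm t)\<^sup>2 / 2)))"
    by (intro tendsto_intros vlim)
  ultimately have "(\<lambda>N. (E (phase (g N) (bs N)) - of_real (exp (- (k / 4 * v N)))) + of_real (exp (- (k / 4 * v N))))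
      \<longlonglongrightarrow> 0 + of_real (exp (- ((norm t)\<^sup>2 / 2)))"
    by (rule tendsto_add)
  then show ?thesis unfolding s_def[symmetric] char by simp
qed

end

section \<open>The central limit theorem\<close>

theorem theorem1:
  fixes f :: "complex \<Rightarrow> complex" and a :: "nat \<Rightarrow> complex" and \<eta> :: real
  assumes "inner_function f"
    and "f 0 = 0"
    and "\<not> disc_rotation f"
    and "\<exists>n\<ge>1. a n \<noteq> 0"
    and "\<eta> > 0"
    and "(\<lambda>N. (SUP n\<in>{1..N}. (norm (a n))\<^sup>2) /
                (\<Sum>n=1..N. (norm (a n))\<^sup>2) powr ((1 - \<eta>) / 2)) \<longlonglongrightarrow> 0"
  shows "converges_to_standard_complex_normal
           (\<lambda>N z. complex_of_real (sqrt 2 / sqrt (sigma_squared f a N)) *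
                    (\<Sum>n=1..N. a n * (boundary_function f ^^ n) z))"
proof -
  define T where "T = circle_map f"
  define c where "c = cnj (deriv f 0)"
  define q where "q = cnj (LINT z|circle_measure. cnj z ^ 2 * T z)"
  interpret circle_factor T c q
    unfolding T_def c_def q_def by (rule circle_factor_inner[OF assms(1-3)])
  obtain n0 where n0: "1 \<le> n0" "a n0 \<noteq> 0" using assms(4) by blast
  define s :: "nat \<Rightarrow> complex" where "s N = of_real (sqrt 2 / sqrt (sigma_squared f a N))" for N
  define X where "X N z = s N * (\<Sum>n=1..N. a n * (boundary_function f ^^ n) z)" for N z
  note \<sigma> = sigma_squared_geometric_sum[of f a, folded c_def]
  have "(\<lambda>N. (SUP n\<in>{1..N}. (norm (a n))\<^sup>2) / (\<Sum>n=1..N. (norm (a n))\<^sup>2)) \<longlonglongrightarrow> 0"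
    by (rule sup_over_sum_tendsto_0[OF _ n0(1) _ _ assms(6)]) (use n0 assms(5) in auto)
  from scaled_sum_character_tendsto[OF n0 this, folded \<sigma>]
  have char: "(\<lambda>N. LINT z|circle_measure. character t (scaled_sum a (s N) N z)) \<longlonglongrightarrow> of_real (exp (- (norm t)\<^sup>2 / 2))" for t
    by (simp add: s_def)
  \<comment> \<open>The mean square is 2 if \<open>sigma_squared f a N > 0\<close>, and 0 otherwise, because then \<open>s N = 0\<close> by division by zero.\<close>
  have second: "(LINT z|circle_measure. (norm (scaled_sum a (s N) N z))\<^sup>2) \<le> 2" for N
  proof -
    have "0 \<le> sigma_squared f a N"
      unfolding \<sigma> using norm_c by (intro add_nonneg_nonneg mult_nonneg_nonneg sum_nonneg) (auto simp: power_le_one)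
    then show ?thesis
      unfolding E_norm_scaled_sum \<sigma>[symmetric] s_def by (simp add: norm_divide power_divide)
  qed
  have Z: "scaled_sum a (s N) N \<in> borel_measurable circle_measure" for N
    using bounded_circle_scaled_sum by (auto simp: bounded_circle_def)
  define M where "M N = distr circle_measure borel (scaled_sum a (s N) N)" for N
  have M: "prob_space (M N)" "sets (M N) = sets borel" for N
    unfolding M_def using Z by (auto intro: circle.prob_space_distr)
  have weak: "(\<lambda>N. LINT w|M N. \<phi> w) \<longlonglongrightarrow> (LINT w|complex_normal. \<phi> w)"
    if \<phi>: "continuous_on UNIV \<phi>" "\<And>w. 0 \<le> \<phi> w \<and> \<phi> w \<le> 1" for \<phi> :: "complex \<Rightarrow> real"
  proof (rule continuity_theorem_complex[OF M prob_space_complex_normal sets_complex_normal])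
    show "(\<lambda>N. LINT w|M N. character t w) \<longlonglongrightarrow> (LINT w|complex_normal. character t w)" for t
      using char[of t] unfolding M_def complex_normal_character
      by (subst integral_distr[OF Z borel_measurable_character])
    show "integrable (M N) (\<lambda>w. (norm w)\<^sup>2)" for N
    proof -
      have "bounded_circle (\<lambda>z. of_real ((norm (scaled_sum a (s N) N z))\<^sup>2))"
        unfolding complex_norm_square by (intro bounded_circle_intros bounded_circle_scaled_sum)
      from bounded_circle_integrable[OF this]
      have "integrable circle_measure (\<lambda>z. (norm (scaled_sum a (s N) N z))\<^sup>2)"
        by (simp only: complex_of_real_integrable_eq)
      then show ?thesis unfolding M_def by (subst integrable_distr_eq[OF Z]) auto
    qed
    show "(LINT w|M N. (norm w)\<^sup>2) \<le> 2" for N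
      unfolding M_def by (subst integral_distr[OF Z]) (auto intro: second)
  qed (use \<phi> complex_normal_second_moment in auto)
  have X: "X N \<in> borel_measurable circle_measure" for N
    using assms(1) unfolding X_def inner_function_def
    by (intro borel_measurable_times borel_measurable_sum borel_measurable_const iterate_measurable) auto
  have law: "measure circle_measure {z \<in> space circle_measure. X N z \<in> K} = measure (M N) K"
    if K: "K \<in> sets borel" for N K
  proof -
    have eq: "AE z in circle_measure. X N z = scaled_sum a (s N) N z"
      using AE_iterates_eq[OF assms(1,2)] by eventually_elim (unfold X_def scaled_sum_def, simp add: T_def)
    have "measure circle_measure {z \<in> space circle_measure. X N z \<in> K} =
          measure circle_measure {z \<in> space circle_measure. scaled_sum a (s N) N z \<in> K}"
      using eq by (intro circle.finite_measure_eq_AE) (use measurable_sets_Collect[OF X] measurable_sets_Collect[OF Z] K in auto)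
    also have "\<dots> = measure (M N) K"
      unfolding M_def using K Z by (subst measure_distr) (auto simp: vimage_def Int_def conj_commute)
    finally show ?thesis .
  qed
  show ?thesis
    unfolding converges_to_standard_complex_normal_def s_def[symmetric] X_def[symmetric]
  proof (intro conjI allI ballI impI)
    show "(\<lambda>z. X N z) \<in> borel_measurable circle_measure" for N by (rule X)
    fix K :: "complex set" assume K: "K \<in> sets borel" and fr: "frontier K \<in> null_sets lborel"
    show "(\<lambda>N. measure circle_measure {z \<in> space circle_measure. X N z \<in> K})
       \<longlonglongrightarrow> 1 / (2 * pi) * (LINT w:K|lborel. exp (- (norm w)\<^sup>2 / 2))"
      unfolding law[OF K] measure_complex_normal[OF K, symmetric]
      by (rule weak_limit_continuity_set[OF M prob_space_complex_normal sets_complex_normal weak K])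
         (use complex_normal_null[OF fr] in auto)
  qed
qed

end
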